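(* Let $\Delta$ be an irreducible spherical building of type $(W,I)$, and let $\Omega$ be a convex chamber subcomplex of $\Delta$. If for some $k\in I$ every vertex of type $k$ in $\Omega$ has an opposite in $\Omega$, then $\Omega$ is completely reducible; that is, for each simplex $A$ in $\Omega$ there is a simplex $B$ in $\Omega$ which is opposite to $A$ in $\Delta$.
   Context: $\Delta$ is regarded as a simplicial complex whose simplices have types $J\subseteq I$ (vertices have types $i\in I$, chambers have type $I$), with $(W,I)$ the associated finite Coxeter system; $\Delta$ is irreducible if the Dynkin (Coxeter) diagram of $(W,I)$ is connected. For a simplex $R$ of type $J$, $\mathrm{St}R$ denotes the collection of all simplices of $\Delta$ containing $R$; it is a building of type $(W_{I\setminus J}, I\setminus J)$. Opposition: two chambers of $\Delta$ are opposite if their convex hull is an apartment of $\Delta$. Two simplices $R$ and $R'$ of $\Delta$ are opposite in $\Delta$ if every chamber of $\mathrm{St}R$ has an opposite in $\mathrm{St}R'$. A simplex of $\Omega$ "has an opposite in $\Omega$" if some simplex of $\Omega$ is opposite to it in $\Delta$. Projections: for simplices $R$ and $S$, $\mathrm{proj}_R(S)$ is the unique simplex of $\mathrm{St}R$ contained in every shortest gallery from $S$ to $R$. Explicitly, for a chamber $C$, $\mathrm{proj}_R(C)$ is the unique chamber containing $R$ at minimal gallery distance from $C$, and $\mathrm{proj}_R(S)$ is the intersection of the chambers $\mathrm{proj}_R(C)$ over all chambers $C$ containing $S$. A subcomplex of $\Delta$ is a set of simplices closed under passing to faces. It is a chamber subcomplex if each of its simplices is contained in a chamber (of $\Delta$)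 belonging to it. A chamber subcomplex $\Omega$ is convex if every shortest gallery of $\Delta$ joining two chambers of $\Omega$ lies in $\Omega$; equivalently, $\mathrm{proj}_R(S)\in\Omega$ for all simplices $R,S$ of $\Omega$. *)

theory Defs
  imports "HOL-Algebra.Multiplicative_Group" "HOL-Algebra.Generated_Groups"
begin

section \<open>Coxeter systems and Coxeter complexes\<close>

text \<open>
  The group presented by the generators \<open>s \<in> I\<close> and the relations \<open>(s t)\<^sup>m = 1\<close>, with \<open>m\<close> the order
  of \<open>s t\<close> in \<open>W\<close>, is described through words over \<open>I\<close>: one step inserts a relator somewhere in a
  word. For \<open>s = t\<close> the relator is \<open>s s\<close>, so formal inverses are not needed. The library sets
  \<open>ord = 0\<close> for elements of infinite order, which gives the empty relator, that is, no relation.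
\<close>

inductive coxeter_step :: "('w, 'm) monoid_scheme \<Rightarrow> 'w set \<Rightarrow> 'w list \<Rightarrow> 'w list \<Rightarrow> bool"
  for W and I where
  "\<lbrakk>s \<in> I; t \<in> I\<rbrakk> \<Longrightarrow>
   coxeter_step W I (u @ v) (u @ concat (replicate (group.ord W (s \<otimes>\<^bsub>W\<^esub> t)) [s, t]) @ v)"

definition coxeter_system :: "('w, 'm) monoid_scheme \<Rightarrow> 'w set \<Rightarrow> bool" where
  "coxeter_system W I \<longleftrightarrow>
     group W \<and> I \<subseteq> carrier W \<and> generate W I = carrier W \<and>
     (\<forall>s\<in>I. group.ord W s = 2) \<and>
     (\<forall>w\<in>lists I. foldr (\<lambda>s x. s \<otimes>\<^bsub>W\<^esub> x) w \<one>\<^bsub>W\<^esub> = \<one>\<^bsub>W\<^esub> \<longrightarrow> equivclp (coxeter_step W I) w [])"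

text \<open>The edges of the Coxeter diagram are the pairs \<open>s \<noteq> t\<close> with \<open>m(s, t) \<ge> 3\<close> (possibly infinite).\<close>

definition coxeter_diagram :: "('w, 'm) monoid_scheme \<Rightarrow> 'w set \<Rightarrow> ('w \<times> 'w) set" where
  "coxeter_diagram W I = {(s, t). s \<in> I \<and> t \<in> I \<and> s \<noteq> t \<and> group.ord W (s \<otimes>\<^bsub>W\<^esub> t) \<noteq> 2}"

definition irreducible_coxeter :: "('w, 'm) monoid_scheme \<Rightarrow> 'w set \<Rightarrow> bool" where
  "irreducible_coxeter W I \<longleftrightarrow> (\<forall>s\<in>I. \<forall>t\<in>I. (s, t) \<in> (coxeter_diagram W I)\<^sup>*)"

text \<open>
  The vertices of type \<open>i\<close> are the cosets of the maximal standard parabolic subgroup generated by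
  \<open>I - {i}\<close>, tagged with \<open>i\<close>. The simplex given by \<open>w\<close> and \<open>J\<close> has type \<open>J\<close> and corresponds to the
  standard coset of \<open>w\<close> modulo the subgroup generated by \<open>I - J\<close>. The empty simplex is included.
\<close>

definition coxeter_complex :: "('w, 'm) monoid_scheme \<Rightarrow> 'w set \<Rightarrow> ('w \<times> 'w set) set set" where
  "coxeter_complex W I =
     {(\<lambda>i. (i, w <#\<^bsub>W\<^esub> generate W (I - {i}))) ` J | w J. w \<in> carrier W \<and> J \<subseteq> I}"


section \<open>Buildings as typed simplicial complexes\<close>

text \<open>
  A complex is given by its set of simplices; \<open>\<tau>\<close> is the type function on vertices, so a simplex
  \<open>R\<close> has type \<open>\<tau> ` R\<close>.
\<close>

definition simplicial_complex :: "'v set set \<Rightarrow> bool" where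
  "simplicial_complex \<Delta> \<longleftrightarrow> \<Delta> \<noteq> {} \<and> (\<forall>R\<in>\<Delta>. finite R \<and> (\<forall>S. S \<subseteq> R \<longrightarrow> S \<in> \<Delta>))"

definition subcomplex :: "'v set set \<Rightarrow> 'v set set \<Rightarrow> bool" where
  "subcomplex \<Delta> \<Omega> \<longleftrightarrow> \<Omega> \<subseteq> \<Delta> \<and> (\<forall>R\<in>\<Omega>. \<forall>S. S \<subseteq> R \<longrightarrow> S \<in> \<Omega>)"

definition typed_iso ::
  "('v \<Rightarrow> 'i) \<Rightarrow> 'v set set \<Rightarrow> ('u \<Rightarrow> 'i) \<Rightarrow> 'u set set \<Rightarrow> ('v \<Rightarrow> 'u) \<Rightarrow> bool" where
  "typed_iso \<tau> A \<sigma> B \<phi> \<longleftrightarrow>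
     bij_betw \<phi> (\<Union>A) (\<Union>B) \<and> (\<lambda>R. \<phi> ` R) ` A = B \<and> (\<forall>v\<in>\<Union>A. \<sigma> (\<phi> v) = \<tau> v)"

text \<open>
  A building of type \<open>(W, I)\<close> with system of apartments \<open>\<A>\<close>. Thickness is not required.
\<close>

definition building ::
  "('w, 'm) monoid_scheme \<Rightarrow> 'w set \<Rightarrow> 'v set set \<Rightarrow> ('v \<Rightarrow> 'w) \<Rightarrow> 'v set set set \<Rightarrow> bool" where
  "building W I \<Delta> \<tau> \<A> \<longleftrightarrow>
     coxeter_system W I \<and> simplicial_complex \<Delta> \<and>
     (\<forall>A\<in>\<A>. subcomplex \<Delta> A \<and> (\<exists>\<phi>. typed_iso \<tau> A fst (coxeter_complex W I) \<phi>)) \<and>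
     (\<forall>R\<in>\<Delta>. \<forall>S\<in>\<Delta>. \<exists>A\<in>\<A>. R \<in> A \<and> S \<in> A) \<and>
     (\<forall>A\<in>\<A>. \<forall>A'\<in>\<A>. \<forall>R\<in>A \<inter> A'. \<forall>S\<in>A \<inter> A'.
        \<exists>\<phi>. typed_iso \<tau> A \<tau> A' \<phi> \<and> (\<forall>v\<in>R \<union> S. \<phi> v = v))"

definition spherical_building ::
  "('w, 'm) monoid_scheme \<Rightarrow> 'w set \<Rightarrow> 'v set set \<Rightarrow> ('v \<Rightarrow> 'w) \<Rightarrow> 'v set set set \<Rightarrow> bool" where
  "spherical_building W I \<Delta> \<tau> \<A> \<longleftrightarrow> building W I \<Delta> \<tau> \<A> \<and> finite (carrier W)"


section \<open>Galleries and convexity\<close>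

definition chamber :: "'i set \<Rightarrow> 'v set set \<Rightarrow> ('v \<Rightarrow> 'i) \<Rightarrow> 'v set \<Rightarrow> bool" where
  "chamber I \<Delta> \<tau> C \<longleftrightarrow> C \<in> \<Delta> \<and> \<tau> ` C = I"

text \<open>Adjacent chambers share a panel; they are automatically distinct.\<close>

definition adjacent :: "'i set \<Rightarrow> ('v \<Rightarrow> 'i) \<Rightarrow> 'v set \<Rightarrow> 'v set \<Rightarrow> bool" where
  "adjacent I \<tau> C D \<longleftrightarrow> (\<exists>i\<in>I. \<tau> ` (C \<inter> D) = I - {i})"

definition gallery ::
  "'i set \<Rightarrow> 'v set set \<Rightarrow> ('v \<Rightarrow> 'i) \<Rightarrow> 'v set \<Rightarrow> 'v set \<Rightarrow> 'v set list \<Rightarrow> bool" where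
  "gallery I \<Delta> \<tau> C D Cs \<longleftrightarrow>
     Cs \<noteq> [] \<and> hd Cs = C \<and> last Cs = D \<and>
     (\<forall>E\<in>set Cs. chamber I \<Delta> \<tau> E) \<and> successively (adjacent I \<tau>) Cs"

definition shortest_gallery ::
  "'i set \<Rightarrow> 'v set set \<Rightarrow> ('v \<Rightarrow> 'i) \<Rightarrow> 'v set \<Rightarrow> 'v set \<Rightarrow> 'v set list \<Rightarrow> bool" where
  "shortest_gallery I \<Delta> \<tau> C D Cs \<longleftrightarrow>
     gallery I \<Delta> \<tau> C D Cs \<and> (\<forall>Ds. gallery I \<Delta> \<tau> C D Ds \<longrightarrow> length Cs \<le> length Ds)"

definition chamber_subcomplex ::
  "'i set \<Rightarrow> 'v set set \<Rightarrow> ('v \<Rightarrow> 'i) \<Rightarrow> 'v set set \<Rightarrow> bool" where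
  "chamber_subcomplex I \<Delta> \<tau> \<Omega> \<longleftrightarrow>
     subcomplex \<Delta> \<Omega> \<and> (\<forall>R\<in>\<Omega>. \<exists>C\<in>\<Omega>. chamber I \<Delta> \<tau> C \<and> R \<subseteq> C)"

definition convex_chamber_subcomplex ::
  "'i set \<Rightarrow> 'v set set \<Rightarrow> ('v \<Rightarrow> 'i) \<Rightarrow> 'v set set \<Rightarrow> bool" where
  "convex_chamber_subcomplex I \<Delta> \<tau> \<Omega> \<longleftrightarrow>
     chamber_subcomplex I \<Delta> \<tau> \<Omega> \<and>
     (\<forall>C\<in>\<Omega>. \<forall>D\<in>\<Omega>. \<forall>Cs. chamber I \<Delta> \<tau> C \<and> chamber I \<Delta> \<tau> D \<and>
        shortest_gallery I \<Delta> \<tau> C D Cs \<longrightarrow> set Cs \<subseteq> \<Omega>)"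


section \<open>Opposition\<close>

definition opposite_chambers ::
  "'i set \<Rightarrow> 'v set set \<Rightarrow> ('v \<Rightarrow> 'i) \<Rightarrow> 'v set set set \<Rightarrow> 'v set \<Rightarrow> 'v set \<Rightarrow> bool" where
  "opposite_chambers I \<Delta> \<tau> \<A> C D \<longleftrightarrow>
     chamber I \<Delta> \<tau> C \<and> chamber I \<Delta> \<tau> D \<and>
     (convex_chamber_subcomplex I \<Delta> \<tau>) hull {C, D} \<in> \<A>"

definition St :: "'v set set \<Rightarrow> 'v set \<Rightarrow> 'v set set" where
  "St \<Delta> R = {S \<in> \<Delta>. R \<subseteq> S}"

text \<open>
  Opposition of simplices is a mutual relation, so the condition is imposed in both directions.
  With one direction only, every simplex would count as opposite to the empty simplex, and more
  generally to every face of a simplex opposite to it.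
\<close>

definition opposite ::
  "'i set \<Rightarrow> 'v set set \<Rightarrow> ('v \<Rightarrow> 'i) \<Rightarrow> 'v set set set \<Rightarrow> 'v set \<Rightarrow> 'v set \<Rightarrow> bool" where
  "opposite I \<Delta> \<tau> \<A> R R' \<longleftrightarrow>
     R \<in> \<Delta> \<and> R' \<in> \<Delta> \<and>
     (\<forall>C\<in>St \<Delta> R. chamber I \<Delta> \<tau> C \<longrightarrow> (\<exists>C'\<in>St \<Delta> R'. opposite_chambers I \<Delta> \<tau> \<A> C C')) \<and>
     (\<forall>C'\<in>St \<Delta> R'. chamber I \<Delta> \<tau> C' \<longrightarrow> (\<exists>C\<in>St \<Delta> R. opposite_chambers I \<Delta> \<tau> \<A> C' C))"

definition has_opposite_in ::
  "'i set \<Rightarrow> 'v set set \<Rightarrow> ('v \<Rightarrow> 'i) \<Rightarrow> 'v set set set \<Rightarrow> 'v set set \<Rightarrow> 'v set \<Rightarrow> bool" where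
  "has_opposite_in I \<Delta> \<tau> \<A> \<Omega> A \<longleftrightarrow> (\<exists>B\<in>\<Omega>. opposite I \<Delta> \<tau> \<A> A B)"

definition completely_reducible ::
  "'i set \<Rightarrow> 'v set set \<Rightarrow> ('v \<Rightarrow> 'i) \<Rightarrow> 'v set set set \<Rightarrow> 'v set set \<Rightarrow> bool" where
  "completely_reducible I \<Delta> \<tau> \<A> \<Omega> \<longleftrightarrow> (\<forall>A\<in>\<Omega>. has_opposite_in I \<Delta> \<tau> \<A> \<Omega> A)"

end

theory Submission
  imports Defs
begin

text \<open>
  Let \<open>\<delta>\<close> be the Weyl distance of the building, \<open>l\<close> the length function of \<open>(W, I)\<close>, \<open>w\<^sub>0\<close> the longest
  element of \<open>W\<close> and \<open>J = I - {k}\<close>. Two chambers are opposite exactly if their Weyl distance is \<open>w\<^sub>0\<close>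
  (lemma \<open>opposite_chambers_iff\<close>), and convexity of \<open>\<Omega>\<close> says that with chambers \<open>C\<close>, \<open>D\<close> it contains
  every chamber \<open>X\<close> with \<open>l(\<delta>(C, X)) + l(\<delta>(X, D)) = l(\<delta>(C, D))\<close>.

  The main point is that one pair of opposite chambers in \<open>\<Omega>\<close> is enough. Such a pair spans an
  apartment, which then lies in \<open>\<Omega>\<close>; and an apartment contains an opposite of every chamber \<open>C\<close> of
  the building: a chamber \<open>D\<close> of the apartment at maximal distance from \<open>C\<close> has, for each \<open>s \<in> I\<close>, an
  \<open>s\<close>-neighbour in the apartment that is no further away, so every \<open>s\<close> is a descent of \<open>\<delta>(C, D)\<close>,
  and hence \<open>\<delta>(C, D) = w\<^sub>0\<close>. A face of \<open>C\<close> is opposite to the face of \<open>D\<close> of the opposite type.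

  To find the pair, use the hypothesis in the form that every chamber \<open>C\<close> of \<open>\<Omega>\<close> has some \<open>D\<close> in \<open>\<Omega>\<close>
  with \<open>\<delta>(C, D) \<in> W\<^sub>J w\<^sub>0\<close>. Among all such pairs in \<open>\<Omega>\<close> choose one with \<open>\<delta>(C, D) = y w\<^sub>0\<close>, \<open>y \<in> W\<^sub>J\<close>,
  and \<open>l(y)\<close> minimal, and suppose \<open>y \<noteq> 1\<close>. Because the diagram is connected, there is an \<open>x\<close> with
  \<open>l(x y) = l(x) + l(y)\<close> and \<open>x y = n r\<close>, where \<open>n \<in> W\<^sub>J\<close> is shorter than \<open>y\<close> and \<open>r\<close> has no left
  descent in \<open>J\<close> (lemma \<open>parabolic_shortening\<close>). The following chambers all lie on shortest galleries
  between chambers of \<open>\<Omega>\<close>, hence in \<open>\<Omega>\<close>, where \<open>w\<^sub>J\<close> is the longest element of \<open>W\<^sub>J\<close>: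
  \<^item> \<open>X\<close> between \<open>C\<close> and \<open>D\<close> with \<open>\<delta>(X, D) = x y w\<^sub>0 = n r w\<^sub>0\<close>;
  \<^item> \<open>Y\<close> between \<open>X\<close> and \<open>D\<close> with \<open>\<delta>(X, Y) = n w\<^sub>J\<close>, the projection of \<open>D\<close> to the star of the vertex
    of type \<open>k\<close> of \<open>X\<close>;
  \<^item> \<open>F\<close> with \<open>\<delta>(Y, F) = w\<^sub>J w\<^sub>0\<close>, between \<open>Y\<close> and a chamber \<open>E\<close> of \<open>\<Omega>\<close> with \<open>\<delta>(Y, E) \<in> W\<^sub>J w\<^sub>0\<close>; it is
    the projection of \<open>Y\<close> to the star of the vertex of \<open>E\<close> opposite to that of \<open>X\<close> and \<open>Y\<close>.

  The lengths of \<open>n w\<^sub>J\<close> and \<open>w\<^sub>J w\<^sub>0\<close> add up, so \<open>\<delta>(X, F) = n w\<^sub>0\<close>, and the pair \<open>(X, F)\<close> contradicts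
  the choice of \<open>y\<close>. Therefore \<open>y = 1\<close>, and \<open>C\<close> and \<open>D\<close> are opposite.
\<close>

section \<open>Words and reflections in a Coxeter group\<close>

locale coxeter = group W for W (structure) and I +
  assumes coxeter_system: "coxeter_system W I"
begin

declare in_lists_conv_set [simp]

lemma gen_subset: "I \<subseteq> carrier W"
  using coxeter_system by (simp add: coxeter_system_def)

lemma gen_closed [simp, intro]: "s \<in> I \<Longrightarrow> s \<in> carrier W"
  using gen_subset by blast

lemma generate_gens: "generate W I = carrier W"
  using coxeter_system by (simp add: coxeter_system_def)

lemma cancel_inv [simp]:
  assumes "x \<in> carrier W" "y \<in> carrier W"
  shows "x \<otimes> (inv x \<otimes> y) = y" "inv x \<otimes> (x \<otimes> y) = y"
  using assms by (simp_all flip: m_assoc)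

lemma conj_eq_iff:
  assumes "a \<in> carrier W" "r \<in> carrier W" "x \<in> carrier W"
  shows "inv a \<otimes> r \<otimes> a = x \<longleftrightarrow> r = a \<otimes> x \<otimes> inv a"
  using assms by (auto simp: m_assoc)

lemma ord_gen: "s \<in> I \<Longrightarrow> ord s = 2"
  using coxeter_system by (simp add: coxeter_system_def)

lemma gen_sq [simp]: "s \<in> I \<Longrightarrow> s \<otimes> s = \<one>"
  using pow_ord_eq_1[of s] ord_gen[of s] by (simp add: numeral_2_eq_2)

lemma gen_cancel [simp]: "\<lbrakk>s \<in> I; y \<in> carrier W\<rbrakk> \<Longrightarrow> s \<otimes> (s \<otimes> y) = y"
  by (simp flip: m_assoc)

lemma inv_gen [simp]: "s \<in> I \<Longrightarrow> inv s = s"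
  by (simp add: inv_equality)

lemma gen_neq_one: "s \<in> I \<Longrightarrow> s \<noteq> \<one>"
  using ord_gen[of s] ord_eq_1[of s] by auto

definition wd :: "'a list \<Rightarrow> 'a" where
  "wd us = foldr (\<lambda>s x. s \<otimes> x) us \<one>"

lemma wd_Nil [simp]: "wd [] = \<one>" and wd_Cons [simp]: "wd (s # us) = s \<otimes> wd us"
  by (simp_all add: wd_def)

lemma wd_closed [simp, intro]: "us \<in> lists I \<Longrightarrow> wd us \<in> carrier W"
  by (induction us) auto

lemma wd_append [simp]: "\<lbrakk>us \<in> lists I; vs \<in> lists I\<rbrakk> \<Longrightarrow> wd (us @ vs) = wd us \<otimes> wd vs"
  by (induction us) (auto simp: m_assoc)

lemma wd_rev: "us \<in> lists I \<Longrightarrow> wd (rev us) = inv (wd us)"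
  by (induction us) (auto simp: inv_mult_group)

lemma generate_words:
  assumes "A \<subseteq> I"
  shows "generate W A = wd ` lists A"
proof
  show "wd ` lists A \<subseteq> generate W A"
  proof -
    have "wd us \<in> generate W A" if "us \<in> lists A" for us
      using that by (induction us) (auto intro: generate.intros)
    then show ?thesis by blast
  qed
  show "generate W A \<subseteq> wd ` lists A"
  proof
    fix w assume "w \<in> generate W A"
    then show "w \<in> wd ` lists A"
    proof induction
      case one
      show ?case by (rule image_eqI[of _ _ "[]"]) auto
    next
      case (incl h)
      then show ?case using assms by (intro image_eqI[of _ _ "[h]"]) auto
    next
      case (inv h)
      then show ?case using assms by (intro image_eqI[of _ _ "[h]"]) auto
    next
      case (eng h1 h2)
      then obtain us vs where "us \<in> lists A" "vs \<in> lists A" "h1 = wd us" "h2 = wd vs" by auto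
      then show ?case using assms
        by (intro image_eqI[of _ _ "us @ vs"]) (auto simp: subset_iff in_lists_conv_set)
    qed
  qed
qed

lemma carrier_words: "w \<in> carrier W \<Longrightarrow> \<exists>us\<in>lists I. wd us = w"
  using generate_words[of I] generate_gens by auto

text \<open>
  The gallery of type \<open>s\<^sub>1 \<dots> s\<^sub>n\<close> from the fundamental chamber crosses the walls of the reflections
  \<open>t\<^sub>i = s\<^sub>1 \<dots> s\<^sub>i\<^sub>-\<^sub>1 s\<^sub>i s\<^sub>i\<^sub>-\<^sub>1 \<dots> s\<^sub>1\<close>. The predicate records the parity of the number of \<open>i\<close> with \<open>t\<^sub>i = t\<close>.
  Unlike the number itself, this parity depends only on the group element that the word represents.
\<close>

primrec crosses :: "'a list \<Rightarrow> 'a \<Rightarrow> bool" where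
  "crosses [] t \<longleftrightarrow> False"
| "crosses (s # us) t \<longleftrightarrow> (t = s) \<noteq> crosses us (s \<otimes> t \<otimes> s)"

lemma crosses_append:
  assumes "us \<in> lists I" "t \<in> carrier W"
  shows "crosses (us @ vs) t \<longleftrightarrow> crosses us t \<noteq> crosses vs (inv (wd us) \<otimes> t \<otimes> wd us)"
  using assms by (induction us arbitrary: t) (auto simp: m_assoc inv_mult_group)

lemma wd_replicate:
  assumes "s \<in> I" "t \<in> I"
  shows "wd (concat (replicate n [s, t])) = (s \<otimes> t) [^] n"
proof (induction n)
  case (Suc n)
  then show ?case using assms by (subst nat_pow_Suc2) (auto simp: m_assoc)
qed simp

lemma replicate_lists: "\<lbrakk>s \<in> I; t \<in> I\<rbrakk> \<Longrightarrow> concat (replicate n [s, t]) \<in> lists I"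
  by (auto simp: in_lists_conv_set)

lemma odd_card_below_double_Suc:
  "odd (card {j. j < 2 * Suc n \<and> P j}) \<longleftrightarrow> odd (card {j. j < 2 * n \<and> P j}) \<noteq> (P (2 * n) \<noteq> P (Suc (2 * n)))"
proof -
  have split: "{j. j < 2 * Suc n \<and> P j} = {j. j < 2 * n \<and> P j} \<union> {j \<in> {2 * n, Suc (2 * n)}. P j}"
    by auto
  have count: "card {j. j < 2 * Suc n \<and> P j} = card {j. j < 2 * n \<and> P j} + card {j \<in> {2 * n, Suc (2 * n)}. P j}"
    unfolding split by (rule card_Un_disjoint) auto
  have last: "{j \<in> {2 * n, Suc (2 * n)}. P j} =
      (if P (2 * n) then {2 * n} else {}) \<union> (if P (Suc (2 * n)) then {Suc (2 * n)} else {})"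
    by auto
  have "odd (card {j \<in> {2 * n, Suc (2 * n)}. P j}) \<longleftrightarrow> P (2 * n) \<noteq> P (Suc (2 * n))"
    unfolding last by simp
  then show ?thesis unfolding count even_add by argo
qed

lemma crosses_alternating:
  assumes st: "s \<in> I" "t \<in> I" and r: "r \<in> carrier W"
  shows "crosses (concat (replicate n [s, t])) r
    \<longleftrightarrow> odd (card {j. j < 2 * n \<and> r = (s \<otimes> t) [^] j \<otimes> s})"
proof (induction n)
  case (Suc n)
  let ?q = "s \<otimes> t" and ?a = "(s \<otimes> t) [^] n"
  have q: "?q \<in> carrier W" "?a \<in> carrier W" using st by auto
  \<comment> \<open>The reflections of the word \<open>(s t)\<^sup>n\<close> are \<open>q\<^sup>j s\<close> for \<open>j < 2 n\<close>, where \<open>q = s t\<close>, because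
    conjugation by \<open>s\<close> inverts \<open>q\<close>.\<close>
  have conj: "?a \<otimes> s \<otimes> inv ?a = ?q [^] (2 * n) \<otimes> s"
  proof -
    have "s \<otimes> inv (?q [^] m) = ?q [^] m \<otimes> s" for m :: nat
    proof (induction m)
      case (Suc m)
      have "s \<otimes> inv (?q [^] Suc m) = s \<otimes> inv ?q \<otimes> inv (?q [^] m)"
        using st by (simp add: inv_mult_group m_assoc)
      also have "s \<otimes> inv ?q = ?q \<otimes> s" using st by (simp add: inv_mult_group m_assoc)
      also have "?q \<otimes> s \<otimes> inv (?q [^] m) = ?q \<otimes> (?q [^] m \<otimes> s)"
        using st Suc by (simp add: m_assoc del: nat_pow_Suc)
      also have "\<dots> = ?q [^] Suc m \<otimes> s"
        using st by (subst nat_pow_Suc2) (auto simp: m_assoc)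
      finally show ?case .
    qed (use st in simp)
    then show ?thesis using st q by (simp add: m_assoc mult_2 flip: nat_pow_mult)
  qed
  have conj': "?a \<otimes> (s \<otimes> t \<otimes> s) \<otimes> inv ?a = ?q [^] Suc (2 * n) \<otimes> s"
  proof -
    have "?a \<otimes> (s \<otimes> t \<otimes> s) \<otimes> inv ?a = (?a \<otimes> ?q) \<otimes> inv ?a \<otimes> (?a \<otimes> s \<otimes> inv ?a)"
      using st q by (simp add: m_assoc)
    also have "?a \<otimes> ?q = ?q \<otimes> ?a" using q(1) by (metis nat_pow_Suc nat_pow_Suc2)
    finally have "?a \<otimes> (s \<otimes> t \<otimes> s) \<otimes> inv ?a = ?q \<otimes> (?q [^] (2 * n) \<otimes> s)"
      using q conj st by (simp add: m_assoc)
    then show ?thesis using q st by (subst nat_pow_Suc2) (auto simp: m_assoc)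
  qed
  have moved: "inv ?a \<otimes> r \<otimes> ?a = x \<longleftrightarrow> r = ?a \<otimes> x \<otimes> inv ?a" if "x \<in> carrier W" for x
    using q r that by (intro conj_eq_iff)
  have "concat (replicate (Suc n) [s, t]) = concat (replicate n [s, t]) @ [s, t]"
    by (simp flip: replicate_append_same)
  then have step: "crosses (concat (replicate (Suc n) [s, t])) r \<longleftrightarrow>
      crosses (concat (replicate n [s, t])) r \<noteq> crosses [s, t] (inv ?a \<otimes> r \<otimes> ?a)"
    using crosses_append[OF replicate_lists[OF st] r] wd_replicate[OF st] by simp
  have last: "crosses [s, t] (inv ?a \<otimes> r \<otimes> ?a) \<longleftrightarrow>
      (r = ?q [^] (2 * n) \<otimes> s) \<noteq> (r = ?q [^] Suc (2 * n) \<otimes> s)"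
  proof -
    have "s \<otimes> x \<otimes> s = t \<longleftrightarrow> x = s \<otimes> t \<otimes> s" if "x \<in> carrier W" for x
      using st that conj_eq_iff[of s x t] by auto
    then have "crosses [s, t] (inv ?a \<otimes> r \<otimes> ?a) \<longleftrightarrow>
      (inv ?a \<otimes> r \<otimes> ?a = s) \<noteq> (inv ?a \<otimes> r \<otimes> ?a = s \<otimes> t \<otimes> s)"
      using q r by auto
    then show ?thesis using moved[of s] moved[of "s \<otimes> t \<otimes> s"] conj conj' st by auto
  qed
  show ?case unfolding step last Suc odd_card_below_double_Suc ..
qed simp

text \<open>
  If \<open>q = s t\<close> has order \<open>m\<close>, then the reflections \<open>q\<^sup>j s\<close> with \<open>j < 2 m\<close> of the relator repeat with
  period \<open>m\<close>, so each of them occurs an even number of times.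
\<close>

lemma crosses_relator:
  assumes st: "s \<in> I" "t \<in> I" and r: "r \<in> carrier W"
  shows "\<not> crosses (concat (replicate (ord (s \<otimes> t)) [s, t])) r"
proof -
  let ?q = "s \<otimes> t" let ?m = "ord ?q"
  let ?P = "\<lambda>j. r = ?q [^] j \<otimes> s"
  have q: "?q \<in> carrier W" using st by auto
  have shift: "?P (j + ?m) \<longleftrightarrow> ?P j" for j
    using q by (simp flip: nat_pow_mult)
  have split: "{j. j < 2 * ?m \<and> ?P j} = {j. j < ?m \<and> ?P j} \<union> (\<lambda>j. j + ?m) ` {j. j < ?m \<and> ?P j}"
  proof (intro equalityI subsetI)
    fix j assume j: "j \<in> {j. j < 2 * ?m \<and> ?P j}"
    show "j \<in> {j. j < ?m \<and> ?P j} \<union> (\<lambda>j. j + ?m) ` {j. j < ?m \<and> ?P j}"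
    proof (cases "j < ?m")
      case False
      then have "j = (j - ?m) + ?m" "j - ?m < ?m" using j by auto
      then show ?thesis using j shift[of "j - ?m"] by (metis (mono_tags, lifting) UnI2 image_eqI mem_Collect_eq)
    qed (use j in auto)
  next
    fix j assume "j \<in> {j. j < ?m \<and> ?P j} \<union> (\<lambda>j. j + ?m) ` {j. j < ?m \<and> ?P j}"
    then show "j \<in> {j. j < 2 * ?m \<and> ?P j}"
      using shift by fastforce
  qed
  have "card {j. j < 2 * ?m \<and> ?P j} = card {j. j < ?m \<and> ?P j} + card {j. j < ?m \<and> ?P j}"
    unfolding split by (subst card_Un_disjoint) (auto simp: card_image)
  then have "even (card {j. j < 2 * ?m \<and> ?P j})" by (simp only: even_add)
  then show ?thesis by (simp only: crosses_alternating[OF st r] not_not)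
qed

lemma coxeter_step_crosses:
  assumes "coxeter_step W I a b"
  shows "(a \<in> lists I \<longleftrightarrow> b \<in> lists I) \<and> (a \<in> lists I \<longrightarrow> (\<forall>r\<in>carrier W. crosses a r \<longleftrightarrow> crosses b r))"
  using assms
proof cases
  case (1 s t u v)
  let ?rel = "concat (replicate (ord (s \<otimes> t)) [s, t])"
  have rel: "?rel \<in> lists I" and one: "wd ?rel = \<one>"
    using 1 by (auto simp: replicate_lists wd_replicate)
  show ?thesis
    using 1 rel one crosses_relator[of s t] by (auto simp: crosses_append)
qed

text \<open>
  By the presentation, a word for the identity is obtained from the empty word by inserting and
  deleting relators, none of which changes the parities.
\<close>

lemma relator_word_crosses:
  assumes "us \<in> lists I" "wd us = \<one>" "r \<in> carrier W"
  shows "\<not> crosses us r"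
proof -
  have "equivclp (coxeter_step W I) us []"
    using assms coxeter_system by (auto simp: coxeter_system_def wd_def)
  then have "equivclp (coxeter_step W I) [] us" by (rule equivclp_sym)
  then have "us \<in> lists I \<and> (\<forall>r\<in>carrier W. \<not> crosses us r)"
    by (induction rule: equivclp_induct) (use coxeter_step_crosses in auto)
  then show ?thesis using assms by blast
qed

text \<open>
  Both words can be followed by the reverse of the second one; the products are the identity, so what
  each word contributes is determined by the common remaining part.
\<close>

lemma crosses_cong:
  assumes "us \<in> lists I" "vs \<in> lists I" "wd us = wd vs" "r \<in> carrier W"
  shows "crosses us r \<longleftrightarrow> crosses vs r"
proof -
  have v: "rev vs \<in> lists I" using assms by auto
  have "wd (us @ rev vs) = \<one>" "wd (vs @ rev vs) = \<one>"
    using assms v wd_append[of us "rev vs"] wd_append[of vs "rev vs"] wd_closed[of vs]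
    by (simp_all add: wd_rev)
  then have "\<not> crosses (us @ rev vs) r" "\<not> crosses (vs @ rev vs) r"
    using assms v relator_word_crosses[of "us @ rev vs" r] relator_word_crosses[of "vs @ rev vs" r]
    by (simp_all add: ball_Un)
  then show ?thesis using assms v by (simp add: crosses_append)
qed

text \<open>
  The wall of the reflection \<open>t\<close> separates the fundamental chamber from its image under \<open>w\<close>.
\<close>

definition sep :: "'a \<Rightarrow> 'a \<Rightarrow> bool" where
  "sep w t \<longleftrightarrow> (\<exists>us\<in>lists I. wd us = w \<and> crosses us t)"

lemma sep_wd: "\<lbrakk>us \<in> lists I; t \<in> carrier W\<rbrakk> \<Longrightarrow> sep (wd us) t \<longleftrightarrow> crosses us t"
  unfolding sep_def using crosses_cong by blast

lemma sep_one [simp]: "t \<in> carrier W \<Longrightarrow> \<not> sep \<one> t"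
  using sep_wd[of "[]" t] by simp

lemma sep_mult:
  assumes "a \<in> carrier W" "b \<in> carrier W" "t \<in> carrier W"
  shows "sep (a \<otimes> b) t \<longleftrightarrow> sep a t \<noteq> sep b (inv a \<otimes> t \<otimes> a)"
proof -
  obtain us vs where w: "us \<in> lists I" "wd us = a" "vs \<in> lists I" "wd vs = b"
    using assms carrier_words by metis
  then show ?thesis
    using sep_wd[of "us @ vs" t] sep_wd[of us t] sep_wd[of vs "inv a \<otimes> t \<otimes> a"] assms
      crosses_append[of us t vs]
    by auto
qed

lemma sep_gen: "\<lbrakk>s \<in> I; t \<in> carrier W\<rbrakk> \<Longrightarrow> sep s t \<longleftrightarrow> t = s"
  using sep_wd[of "[s]" t] by simp

text \<open>
  If \<open>t\<close> is the reflection \<open>t\<^sub>i\<close> of a word, then multiplying by \<open>t\<close> amounts to deleting the \<open>i\<close>-th letter: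
  the gallery is folded along the wall it crosses there. This is the source of the exchange condition.
\<close>

lemma crosses_delete:
  assumes "us \<in> lists I" "t \<in> carrier W" "crosses us t"
  shows "\<exists>vs s ws. us = vs @ s # ws \<and> t \<otimes> wd us = wd (vs @ ws) \<and> t = wd vs \<otimes> s \<otimes> inv (wd vs)"
  using assms
proof (induction us arbitrary: t)
  case (Cons s us)
  have us: "wd us \<in> carrier W" "s \<in> I" "s \<in> carrier W" "t \<in> carrier W"
    using Cons.hyps Cons.prems by auto
  show ?case
  proof (cases "t = s")
    case True
    have "s # us = [] @ s # us" "t \<otimes> wd (s # us) = wd ([] @ us)" "t = wd [] \<otimes> s \<otimes> inv (wd [])"
      using True us by auto
    then show ?thesis by blast
  next
    case False
    then have "crosses us (s \<otimes> t \<otimes> s)" using Cons.prems by simp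
    moreover have "s \<otimes> t \<otimes> s \<in> carrier W" using us by simp
    ultimately obtain vs x ws where *: "us = vs @ x # ws" "s \<otimes> t \<otimes> s \<otimes> wd us = wd (vs @ ws)"
        "s \<otimes> t \<otimes> s = wd vs \<otimes> x \<otimes> inv (wd vs)"
      using Cons.IH by blast
    have vs: "wd vs \<in> carrier W" "x \<in> carrier W" using Cons.hyps *(1) by auto
    have "t \<otimes> (s \<otimes> wd us) = s \<otimes> (s \<otimes> t \<otimes> s \<otimes> wd us)"
      using us by (simp add: m_assoc)
    moreover have "t = s \<otimes> (s \<otimes> t \<otimes> s) \<otimes> s" using us by (simp add: m_assoc)
    then have "t = s \<otimes> (wd vs \<otimes> x \<otimes> inv (wd vs)) \<otimes> s" using * by simp
    then have "t = s \<otimes> wd vs \<otimes> x \<otimes> inv (s \<otimes> wd vs)"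
      using vs us by (simp add: m_assoc inv_mult_group)
    ultimately show ?thesis using * by (intro exI[of _ "s # vs"] exI[of _ x] exI[of _ ws]) simp
  qed
qed simp

section \<open>Length and the exchange condition\<close>

definition len :: "'a \<Rightarrow> nat" where
  "len w = (LEAST n. \<exists>us\<in>lists I. wd us = w \<and> length us = n)"

lemma reduced_word: "w \<in> carrier W \<Longrightarrow> \<exists>us\<in>lists I. wd us = w \<and> length us = len w"
  unfolding len_def by (rule LeastI_ex) (use carrier_words in blast)

lemma len_wd_le: "us \<in> lists I \<Longrightarrow> len (wd us) \<le> length us"
  unfolding len_def by (rule Least_le) blast

lemma len_one [simp]: "len \<one> = 0"
  using len_wd_le[of "[]"] by simp

lemma len_eq_0_iff [simp]: "w \<in> carrier W \<Longrightarrow> len w = 0 \<longleftrightarrow> w = \<one>"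
  using reduced_word[of w] by auto

lemma len_mult_le:
  assumes "a \<in> carrier W" "b \<in> carrier W"
  shows "len (a \<otimes> b) \<le> len a + len b"
proof -
  obtain us vs where w: "us \<in> lists I" "wd us = a" "length us = len a"
      "vs \<in> lists I" "wd vs = b" "length vs = len b"
    using reduced_word[OF assms(1)] reduced_word[OF assms(2)] by blast
  then have "us @ vs \<in> lists I" "wd (us @ vs) = a \<otimes> b" by auto
  then show ?thesis using len_wd_le[of "us @ vs"] w by simp
qed

lemma len_inv [simp]:
  assumes "w \<in> carrier W"
  shows "len (inv w) = len w"
proof -
  have "len (inv w) \<le> len w" if w: "w \<in> carrier W" for w
  proof -
    obtain us where "us \<in> lists I" "wd us = w" "length us = len w"
      using reduced_word[OF w] by blast
    then show ?thesis using len_wd_le[of "rev us"] by (simp add: wd_rev)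
  qed
  from this[of w] this[of "inv w"] show ?thesis using assms by simp
qed

lemma sep_delete:
  assumes "us \<in> lists A" "A \<subseteq> I" "t \<in> carrier W" "sep (wd us) t"
  shows "\<exists>vs\<in>lists A. t \<otimes> wd us = wd vs \<and> length vs < length us" "t \<in> generate W A"
proof -
  have us: "us \<in> lists I" using assms(1,2) by auto
  then have "crosses us t" using assms sep_wd by blast
  then obtain vs s ws where *: "us = vs @ s # ws" "t \<otimes> wd us = wd (vs @ ws)"
      "t = wd vs \<otimes> s \<otimes> inv (wd vs)"
    using crosses_delete[OF us assms(3)] by blast
  have "vs @ ws \<in> lists A" "length (vs @ ws) < length us" using *(1) assms(1) by auto
  with *(2) show "\<exists>vs\<in>lists A. t \<otimes> wd us = wd vs \<and> length vs < length us" by metis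
  have parts: "vs \<in> lists A" "s \<in> A" using *(1) assms(1) by auto
  then have "vs \<in> lists I" "s \<in> I" using assms(2) by auto
  then have "t = wd (vs @ s # rev vs)"
    using *(3) wd_append[of vs "s # rev vs"] by (simp add: wd_rev m_assoc)
  moreover have "vs @ s # rev vs \<in> lists A" using parts by auto
  ultimately show "t \<in> generate W A" using generate_words[OF assms(2)] by blast
qed

lemma len_sep:
  assumes "w \<in> carrier W" "t \<in> carrier W" "sep w t"
  shows "len (t \<otimes> w) < len w"
proof -
  obtain us where us: "us \<in> lists I" "wd us = w" "length us = len w"
    using assms reduced_word by metis
  then obtain vs where "vs \<in> lists I" "t \<otimes> w = wd vs" "length vs < len w"
    using sep_delete(1)[of us I t] assms by auto
  then show ?thesis using len_wd_le[of vs] by simp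
qed

lemma len_gen [simp]: "s \<in> I \<Longrightarrow> len s = 1"
  using len_wd_le[of "[s]"] len_eq_0_iff[of s] gen_neq_one[of s] by (cases "len s") auto

text \<open>
  Multiplication by \<open>s\<close> on the left toggles whether the wall of \<open>s\<close> separates. If it does not separate
  for \<open>w\<close>, it does for \<open>s w\<close>, so \<open>s (s w) = w\<close> is shorter than \<open>s w\<close>.
\<close>

lemma len_not_sep:
  assumes "s \<in> I" "w \<in> carrier W" "\<not> sep w s"
  shows "len (s \<otimes> w) = Suc (len w)"
proof -
  have "sep (s \<otimes> w) s" using assms sep_mult[of s w s] sep_gen[of s s] by simp
  then have "len w < len (s \<otimes> w)" using len_sep[of "s \<otimes> w" s] assms by simp
  then show ?thesis using len_mult_le[of s w] assms by simp
qed

lemma sep_gen_iff: "\<lbrakk>s \<in> I; w \<in> carrier W\<rbrakk> \<Longrightarrow> sep w s \<longleftrightarrow> len (s \<otimes> w) < len w"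
  using len_sep[of w s] len_not_sep[of s w] by (cases "sep w s") auto

lemma len_gen_cases:
  assumes "s \<in> I" "w \<in> carrier W"
  shows "len (s \<otimes> w) = Suc (len w) \<or> Suc (len (s \<otimes> w)) = len w"
  using len_not_sep[of s w] len_not_sep[of s "s \<otimes> w"] sep_gen_iff[of s w] sep_gen_iff[of s "s \<otimes> w"] assms
  by (cases "sep w s") auto

lemma len_eq_1_iff:
  assumes "w \<in> carrier W"
  shows "len w = 1 \<longleftrightarrow> w \<in> I"
proof
  assume "len w = 1"
  then obtain us where "us \<in> lists I" "wd us = w" "length us = 1"
    using assms reduced_word by metis
  then show "w \<in> I" by (cases us) auto
qed simp

lemma first_letter:
  assumes "w \<in> carrier W" "w \<noteq> \<one>"
  shows "\<exists>s\<in>I. \<exists>v\<in>carrier W. w = s \<otimes> v \<and> len w = Suc (len v)"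
proof -
  obtain us where us: "us \<in> lists I" "wd us = w" "length us = len w"
    using assms reduced_word by metis
  then obtain s vs where [simp]: "us = s # vs" using assms by (cases us) auto
  have "s \<in> I" "wd vs \<in> carrier W" using us by auto
  moreover have "len w = Suc (len (wd vs))"
    using us len_wd_le[of vs] len_gen_cases[of s "wd vs"] by auto
  ultimately show ?thesis using us by auto
qed

lemma last_letter:
  assumes "w \<in> carrier W" "w \<noteq> \<one>"
  shows "\<exists>s\<in>I. \<exists>v\<in>carrier W. w = v \<otimes> s \<and> len w = Suc (len v)"
proof -
  have "inv w \<noteq> \<one>" using assms by simp
  then obtain s v where s: "s \<in> I" "v \<in> carrier W" "inv w = s \<otimes> v" "len (inv w) = Suc (len v)"
    using first_letter[of "inv w"] assms by blast
  have "w = inv (s \<otimes> v)" using s(3) assms by (metis inv_inv)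
  then have "w = inv v \<otimes> s" using s by (simp add: inv_mult_group)
  moreover have "len w = Suc (len (inv v))" using s(2,4) assms by simp
  ultimately show ?thesis using s(1,2) by blast
qed

lemma reduce_word:
  assumes "A \<subseteq> I" "us \<in> lists A"
  shows "\<exists>vs\<in>lists A. wd vs = wd us \<and> length vs = len (wd us)"
  using assms(2)
proof (induction us)
  case Nil
  then show ?case by auto
next
  case (Cons s us)
  then obtain vs where vs: "vs \<in> lists A" "wd vs = wd us" "length vs = len (wd us)" by blast
  have s: "s \<in> I" "vs \<in> lists I" "us \<in> lists I" using Cons vs assms by auto
  then have wc: "wd us \<in> carrier W" by blast
  show ?case
  proof (cases "sep (wd vs) s")
    case True
    then obtain ws where "ws \<in> lists A" "s \<otimes> wd vs = wd ws" "length ws < length vs"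
      using sep_delete(1)[OF vs(1) assms(1)] s by blast
    moreover have "len (s \<otimes> wd vs) = length vs - 1"
      using len_gen_cases[of s "wd vs"] sep_gen_iff[of s "wd vs"] True s(1) vs wc by auto
    moreover have "ws \<in> lists I" using \<open>ws \<in> lists A\<close> assms(1) by auto
    ultimately show ?thesis using vs len_wd_le[of ws] by (intro bexI[of _ ws]) auto
  next
    case False
    then have "len (s \<otimes> wd vs) = Suc (length vs)"
      using len_not_sep[of s "wd vs"] s(1) vs wc by auto
    then show ?thesis using vs Cons by (intro bexI[of _ "s # vs"]) auto
  qed
qed

lemma generate_reduced_word:
  assumes "A \<subseteq> I" "w \<in> generate W A"
  shows "\<exists>us\<in>lists A. wd us = w \<and> length us = len w"
proof -
  from assms obtain vs where "vs \<in> lists A" "wd vs = w" unfolding generate_words[OF assms(1)] by auto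
  then show ?thesis using reduce_word[OF assms(1)] by metis
qed

lemma word_in_generate: "\<lbrakk>A \<subseteq> I; us \<in> lists A\<rbrakk> \<Longrightarrow> wd us \<in> generate W A"
  using generate_words by blast

section \<open>Supports and standard parabolic subgroups\<close>

text \<open>
  Every reduced word of \<open>w\<close> has the same letters (lemma \<open>reduced_letters\<close>), so the union over all
  reduced words is the set of letters of any one of them.
\<close>

definition supp :: "'a \<Rightarrow> 'a set" where
  "supp w = {s. \<exists>us\<in>lists I. wd us = w \<and> length us = len w \<and> s \<in> set us}"

lemma supp_subset: "supp w \<subseteq> I"
  by (auto simp: supp_def)

lemma generate_closed: "\<lbrakk>A \<subseteq> I; w \<in> generate W A\<rbrakk> \<Longrightarrow> w \<in> carrier W"
  using generate_in_carrier gen_subset by blast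

lemma generate_mult: "\<lbrakk>a \<in> generate W A; b \<in> generate W A\<rbrakk> \<Longrightarrow> a \<otimes> b \<in> generate W A"
  by (rule generate.eng)

lemma generate_inv: "\<lbrakk>A \<subseteq> I; a \<in> generate W A\<rbrakk> \<Longrightarrow> inv a \<in> generate W A"
  using generate_m_inv_closed gen_subset by blast

text \<open>
  The first letter \<open>s\<close> of the word is a descent, so the wall of \<open>s\<close> is crossed by any word over \<open>A\<close> for
  the same element. Hence \<open>s\<close> is conjugate, inside the subgroup generated by \<open>A\<close>, to a letter of \<open>A\<close>,
  and since \<open>s\<close> has length one, it is itself a letter of \<open>A\<close>.
\<close>

lemma reduced_letters:
  assumes "A \<subseteq> I" "us \<in> lists I" "length us = len (wd us)" "wd us \<in> generate W A"
  shows "us \<in> lists A"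
  using assms(2-)
proof (induction us rule: list.induct)
  case (Cons s us)
  have s: "s \<in> I" "us \<in> lists I" using Cons.prems(1) by auto
  then have wc: "wd us \<in> carrier W" by blast
  note s = s wc
  obtain vs where vs: "vs \<in> lists A" "wd vs = s \<otimes> wd us" "length vs = len (s \<otimes> wd us)"
    using generate_reduced_word[OF assms(1), of "s \<otimes> wd us"] Cons.prems(3) by auto
  have len: "len (s \<otimes> wd us) = Suc (length us)" "len (wd us) = length us"
    using Cons.prems(2) len_wd_le[OF s(2)] len_gen_cases[of s "wd us"] s by auto
  have "sep (wd vs) s"
    using sep_gen_iff[of s "wd vs"] s vs(2) len by simp
  then have sA: "s \<in> generate W A" using sep_delete(2)[OF vs(1) assms(1)] s by simp
  then obtain ws where ws: "ws \<in> lists A" "wd ws = s" "length ws = 1"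
    using generate_reduced_word[OF assms(1) sA] s by auto
  then have "s \<in> A" using assms(1) by (cases ws) auto
  have "s \<otimes> (s \<otimes> wd us) \<in> generate W A"
    using generate_mult[OF sA Cons.prems(3)] by simp
  then have "wd us \<in> generate W A" using s by simp
  then show ?case using Cons.IH s len \<open>s \<in> A\<close> by auto
qed simp

lemma generate_iff_supp:
  assumes "A \<subseteq> I"
  shows "w \<in> generate W A \<longleftrightarrow> w \<in> carrier W \<and> supp w \<subseteq> A"
proof
  assume w: "w \<in> generate W A"
  then show "w \<in> carrier W \<and> supp w \<subseteq> A"
    using reduced_letters[OF assms] generate_closed[OF assms] by (fastforce simp: supp_def)
next
  assume w: "w \<in> carrier W \<and> supp w \<subseteq> A"
  then obtain us where us: "us \<in> lists I" "wd us = w" "length us = len w"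
    using reduced_word by metis
  then have "us \<in> lists A" using w by (auto simp: supp_def)
  then show "w \<in> generate W A" using us generate_words[OF assms] by auto
qed

lemma in_generate_supp: "w \<in> carrier W \<Longrightarrow> w \<in> generate W (supp w)"
  using generate_iff_supp supp_subset by blast

lemma generate_Int:
  assumes "A \<subseteq> I" "B \<subseteq> I" "w \<in> generate W A" "w \<in> generate W B"
  shows "w \<in> generate W (A \<inter> B)"
  using assms generate_iff_supp[of A w] generate_iff_supp[of B w] generate_iff_supp[of "A \<inter> B" w] by auto

lemma generate_empty: "w \<in> generate W {} \<Longrightarrow> w = \<one>"
  using generate_words[of "{}"] by auto

lemma generate_single:
  assumes "s \<in> I" "w \<in> generate W {s}"
  shows "w = \<one> \<or> w = s"
proof -
  obtain us where us: "us \<in> lists {s}" "wd us = w" using assms generate_words[of "{s}"] by auto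
  have "wd us = \<one> \<or> wd us = s"
    using us(1) by (induction us) (use assms(1) in auto)
  then show ?thesis using us by simp
qed

lemma supp_one [simp]: "supp \<one> = {}"
  by (auto simp: supp_def)

lemma supp_empty_iff: "w \<in> carrier W \<Longrightarrow> supp w = {} \<longleftrightarrow> w = \<one>"
  by (metis generate_empty in_generate_supp supp_one)

lemma supp_gen [simp]:
  assumes "s \<in> I"
  shows "supp s = {s}"
proof -
  have "s \<in> generate W {s}" by (simp add: generate.incl)
  then have "supp s \<subseteq> {s}" using generate_iff_supp[of "{s}" s] assms by simp
  then show ?thesis using supp_empty_iff[of s] gen_neq_one[OF assms] assms by auto
qed

lemma supp_singleton_iff: "\<lbrakk>w \<in> carrier W; s \<in> I\<rbrakk> \<Longrightarrow> supp w = {s} \<longleftrightarrow> w = s"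
  by (metis generate_single in_generate_supp insert_not_empty supp_gen supp_one)

lemma supp_mult:
  assumes "a \<in> carrier W" "b \<in> carrier W"
  shows "supp (a \<otimes> b) \<subseteq> supp a \<union> supp b"
proof -
  have "generate W (supp a) \<subseteq> generate W (supp a \<union> supp b)"
       "generate W (supp b) \<subseteq> generate W (supp a \<union> supp b)"
    using mono_generate[of "supp a" "supp a \<union> supp b"] mono_generate[of "supp b" "supp a \<union> supp b"]
    by auto
  then have "a \<otimes> b \<in> generate W (supp a \<union> supp b)"
    using in_generate_supp[OF assms(1)] in_generate_supp[OF assms(2)] generate_mult by blast
  then show ?thesis using generate_iff_supp[of "supp a \<union> supp b"] supp_subset by blast
qed

text \<open>
  If \<open>s a' b\<close> were shorter than \<open>a' b\<close> while \<open>s a'\<close> is longer than \<open>a'\<close>, the wall of \<open>s\<close> would be crossed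
  by the part \<open>b\<close> of the gallery. Then the conjugate of \<open>s\<close> by \<open>a'\<close> would lie in both parabolic subgroups,
  which meet trivially.
\<close>

lemma len_mult_disjoint:
  assumes A: "A \<subseteq> I" "B \<subseteq> I" "A \<inter> B = {}" and b: "b \<in> generate W B" and a: "a \<in> generate W A"
  shows "len (a \<otimes> b) = len a + len b"
proof -
  obtain us where us: "us \<in> lists A" "wd us = a" "length us = len a"
    using generate_reduced_word[OF A(1) a] by blast
  obtain vs where vs: "vs \<in> lists B" "wd vs = b"
    using generate_reduced_word[OF A(2) b] by blast
  have bc: "b \<in> carrier W" using b generate_closed A by blast
  have "length us = len (wd us) \<Longrightarrow> len (wd us \<otimes> b) = length us + len b"
    using us(1)
  proof (induction us rule: list.induct)
    case (Cons s us)
    have s: "s \<in> I" "s \<in> A" "us \<in> lists A" "us \<in> lists I" using Cons.prems(2) A by auto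
    then have wc: "wd us \<in> carrier W" by blast
    note s = s wc
    have len: "len (s \<otimes> wd us) = Suc (length us)" "len (wd us) = length us"
      using Cons.prems(1) len_wd_le[OF s(4)] len_gen_cases[of s "wd us"] s by auto
    have nsep: "\<not> sep (wd us) s" using len sep_gen_iff[of s "wd us"] s by simp
    let ?r = "inv (wd us) \<otimes> s \<otimes> wd us"
    have "\<not> sep b ?r"
    proof
      assume "sep b ?r"
      then have "?r \<in> generate W B" using sep_delete(2)[OF vs(1) A(2)] s vs by simp
      moreover have "?r \<in> generate W A"
      proof -
        have "wd us \<in> generate W A" using s(3) word_in_generate[OF A(1)] by blast
        then show ?thesis
          using generate_mult generate_inv[OF A(1)] generate.incl[of s A W] s(2) by blast
      qed
      ultimately have "?r = \<one>" using generate_Int[OF A(1,2)] generate_empty A(3) by auto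
      then have "s = \<one>" using conj_eq_iff[of "wd us" s \<one>] s by simp
      then show False using gen_neq_one s by blast
    qed
    then have "\<not> sep (wd us \<otimes> b) s" using nsep sep_mult[of "wd us" b s] s bc by simp
    then show ?case
      using len_not_sep[of s "wd us \<otimes> b"] Cons.IH len s bc by (simp add: m_assoc)
  qed (use bc in simp)
  then show ?thesis using us by simp
qed

text \<open>
  By the exchange condition, \<open>u\<close> has reduced words beginning with any given reduced word over \<open>J\<close>: a letter
  that has to be deleted in order to put a new letter in front cannot belong to the part over \<open>J\<close>,
  as that part with the new letter in front is still reduced. Applied to \<open>J = I\<close> and the longest element of a finite group this
  gives the usual formula for the length of \<open>m w\<^sub>0\<close>.
\<close>

lemma coset_maximal:
  assumes J: "J \<subseteq> I" and u: "u \<in> carrier W" and desc: "\<And>s. s \<in> J \<Longrightarrow> len (s \<otimes> u) < len u"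
    and m: "m \<in> generate W J"
  shows "len (m \<otimes> u) + len m = len u"
proof -
  have *: "len (inv (wd us) \<otimes> u) + length us = len u" if "us \<in> lists J" "length us = len (wd us)" for us
    using that
  proof (induction us rule: list.induct)
    case (Cons s us)
    have s: "s \<in> I" "s \<in> J" "us \<in> lists J" "us \<in> lists I" using Cons.prems(1) J by auto
    then have wc: "wd us \<in> carrier W" by blast
    note s = s wc
    let ?v = "wd us"
    have len: "len (s \<otimes> ?v) = Suc (length us)" "len ?v = length us"
      using Cons.prems(2) len_wd_le[OF s(4)] len_gen_cases[of s "wd us"] s by auto
    have nsep: "\<not> sep ?v s" using len sep_gen_iff[of s "wd us"] s by simp
    let ?c = "inv ?v \<otimes> u"
    have IH: "len ?c + length us = len u" using Cons.IH s len by simp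
    have "sep u s" using desc s sep_gen_iff u by blast
    then have "sep (?v \<otimes> ?c) s" using s u by simp
    then have "sep ?c (inv ?v \<otimes> s \<otimes> ?v)"
      using nsep sep_mult[of ?v ?c s] s u by simp
    then have "len (inv ?v \<otimes> s \<otimes> ?v \<otimes> ?c) < len ?c"
      using len_sep[of ?c "inv ?v \<otimes> s \<otimes> ?v"] s u by simp
    moreover have "inv ?v \<otimes> s \<otimes> ?v \<otimes> ?c = inv (wd (s # us)) \<otimes> u"
      using s u by (simp add: m_assoc inv_mult_group)
    moreover have "len u \<le> len (inv (wd (s # us)) \<otimes> u) + length (s # us)"
      using len_mult_le[of "wd (s # us)" "inv (wd (s # us)) \<otimes> u"] s u Cons.prems(2) by simp
    ultimately show ?case using IH by simp
  qed (use u in simp)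
  obtain us where us: "us \<in> lists J" "wd us = inv m" "length us = len (inv m)"
    using generate_reduced_word[OF J generate_inv[OF J m]] by blast
  then show ?thesis using *[of us] m generate_closed[OF J m] by simp
qed

section \<open>Shortening modulo a maximal parabolic subgroup\<close>

text \<open>
  The conjugate lies in the intersection of two standard parabolic subgroups that does not involve \<open>a\<close>,
  hence in the subgroup of order two generated by \<open>s\<close>.
\<close>

lemma comm_of_conj:
  assumes a: "a \<in> I" "a \<notin> A" "A \<subseteq> I" and s: "s \<in> I" and r: "a \<otimes> s \<otimes> a \<in> generate W A"
  shows "a \<otimes> s = s \<otimes> a"
proof -
  have "a \<otimes> s \<otimes> a \<in> generate W {a, s}"
    by (intro generate_mult) (auto intro: generate.incl)
  then have "a \<otimes> s \<otimes> a \<in> generate W (A \<inter> {a, s})"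
    using generate_Int[OF a(3) _ r, of "{a, s}"] a s by blast
  moreover have "generate W (A \<inter> {a, s}) \<subseteq> generate W {s}"
    using a by (intro mono_generate) auto
  ultimately have "a \<otimes> s \<otimes> a = \<one> \<or> a \<otimes> s \<otimes> a = s" using generate_single s by blast
  then have "s = \<one> \<or> s = a \<otimes> s \<otimes> a"
    using conj_eq_iff[of a s \<one>] conj_eq_iff[of a s s] a s by auto
  then have "s = a \<otimes> s \<otimes> a" using gen_neq_one s by auto
  then have "s \<otimes> a = a \<otimes> s \<otimes> a \<otimes> a" by simp
  then show ?thesis using a s by (simp add: m_assoc)
qed

lemma diagram_noncomm:
  assumes "(s, t) \<in> coxeter_diagram W I"
  shows "s \<in> I" "t \<in> I" "s \<otimes> t \<noteq> t \<otimes> s"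
proof -
  show st: "s \<in> I" "t \<in> I" using assms by (auto simp: coxeter_diagram_def)
  show "s \<otimes> t \<noteq> t \<otimes> s"
  proof
    assume comm: "s \<otimes> t = t \<otimes> s"
    have "(s \<otimes> t) [^] (2::nat) = (s \<otimes> t) \<otimes> (t \<otimes> s)"
      using st comm by (simp add: numeral_2_eq_2)
    also have "\<dots> = \<one>" using st by (simp add: m_assoc)
    finally have dvd: "ord (s \<otimes> t) dvd 2" using st pow_eq_id[of "s \<otimes> t" 2] by simp
    have "ord (s \<otimes> t) \<le> 2" by (rule dvd_imp_le[OF dvd]) simp
    moreover have "ord (s \<otimes> t) \<noteq> 0" using dvd by (intro notI) simp
    ultimately have "ord (s \<otimes> t) = 1 \<or> ord (s \<otimes> t) = 2" by linarith
    moreover have "ord (s \<otimes> t) \<noteq> 2" "s \<noteq> t" using assms by (auto simp: coxeter_diagram_def)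
    moreover have "s = t" if "s \<otimes> t = \<one>"
      using that st inv_equality[of s t] by simp
    ultimately show False using st ord_eq_1[of "s \<otimes> t"] by auto
  qed
qed

text \<open>
  A descent of a word without repeated letters can be moved to the front, so it is a letter commuting
  with all letters before it. On a path of the diagram only the first letter has this property.
\<close>

lemma descent_of_path:
  assumes "us \<in> lists I" "distinct us" "successively (\<lambda>s t. s \<otimes> t \<noteq> t \<otimes> s) us" "us \<noteq> []"
    and "s \<in> I" "sep (wd us) s"
  shows "s = hd us"
  using assms
proof (induction us rule: list.induct)
  case (Cons a us)
  have a: "a \<in> I" "a \<notin> set us" "us \<in> lists I" "set us \<subseteq> I" using Cons.prems by auto
  then have uc: "wd us \<in> carrier W" by blast
  note s = \<open>s \<in> I\<close>
  show ?case
  proof (rule ccontr)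
    assume "s \<noteq> hd (a # us)"
    then have ne: "s \<noteq> a" by simp
    have "sep (a \<otimes> wd us) s" using Cons.prems by simp
    then have *: "sep (wd us) (a \<otimes> s \<otimes> a)"
      using sep_mult[of a "wd us" s] sep_gen[of a s] a uc s ne by simp
    then have "a \<otimes> s \<otimes> a \<in> generate W (set us)"
      using sep_delete(2)[of us "set us" "a \<otimes> s \<otimes> a"] a s by simp
    then have comm: "a \<otimes> s = s \<otimes> a" using comm_of_conj[of a "set us" s] a s by blast
    then have "a \<otimes> s \<otimes> a = s" using a s by (simp add: m_assoc)
    then have sep: "sep (wd us) s" using * by simp
    show False
    proof (cases us)
      case Nil
      then show False using sep s by simp
    next
      case (Cons b vs)
      then have "s = b" using Cons.IH Cons.prems sep s by auto
      then show False using Cons.prems Cons comm by auto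
    qed
  qed
qed simp

text \<open>
  Let \<open>Y\<close> be the support of \<open>y\<close>. Follow a path in the diagram from \<open>k\<close> towards \<open>Y\<close> up to the first vertex
  \<open>e\<close> adjacent to \<open>Y\<close>; the vertices before \<open>e\<close> commute with \<open>Y\<close>. Let \<open>x\<close> be the product along the path,
  let \<open>Z\<close> be the part of \<open>Y\<close> commuting with \<open>e\<close>, and split off from \<open>y\<close> a longest left factor \<open>n \<in> W\<^sub>Z\<close>,
  so that \<open>y = n r'\<close>. As \<open>n\<close> commutes with \<open>x\<close>, we get \<open>x y = n (x r')\<close>. A left descent of \<open>x r'\<close>
  other than \<open>k\<close> would lie in \<open>Z\<close> and be a descent of \<open>r'\<close>, against the choice of \<open>n\<close>. Finally
  \<open>n\<close> is shorter than \<open>y\<close>, since \<open>e\<close> does not commute with all of \<open>Y\<close>.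
\<close>

lemma parabolic_shortening:
  assumes irr: "irreducible_coxeter W I" and k: "k \<in> I"
    and y: "y \<in> generate W (I - {k})" "y \<noteq> \<one>"
  shows "\<exists>x\<in>carrier W. \<exists>n\<in>generate W (I - {k}). \<exists>r\<in>carrier W.
    len (x \<otimes> y) = len x + len y \<and> x \<otimes> y = n \<otimes> r \<and> len n < len y \<and>
    (\<forall>s\<in>I - {k}. len (s \<otimes> r) = Suc (len r))"
proof -
  define Y where "Y = supp y"
  define Q where "Q = {i \<in> I - Y. \<forall>t\<in>Y. i \<otimes> t = t \<otimes> i}"
  have yc: "y \<in> carrier W" using y generate_closed[of "I - {k}"] by auto
  have Y: "Y \<subseteq> I" "k \<notin> Y" "y \<in> generate W Y"
    using y generate_iff_supp[of "I - {k}" y] in_generate_supp[OF yc] by (auto simp: Y_def)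
  have "Y \<noteq> {}" using y yc supp_empty_iff by (simp add: Y_def)
  then obtain t0 where t0: "t0 \<in> Y" by blast
  \<comment> \<open>The path, found by walking from \<open>k\<close> to some vertex of \<open>Y\<close>: as long as the walk stays in \<open>Q\<close> it is kept
    without repetitions, and the first vertex outside \<open>Q\<close> is \<open>e\<close>. It is not in \<open>Y\<close>: it is either \<open>k\<close>,
    or adjacent to the vertex of \<open>Q\<close> before it, which commutes with \<open>Y\<close>.\<close>
  have "\<exists>us e. us \<in> lists Q \<and> e \<in> I - Y \<and> e \<notin> Q \<and> distinct us \<and>
      successively (\<lambda>s t. s \<otimes> t \<noteq> t \<otimes> s) (us @ [e]) \<and> hd (us @ [e]) = k"
  proof (cases "k \<in> Q")
    case False
    then show ?thesis using k Y by (intro exI[of _ "[]"] exI[of _ k]) simp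
  next
    case True
    let ?goal = ?thesis
    have "(k, t0) \<in> (coxeter_diagram W I)\<^sup>*"
      using irr k t0 Y by (auto simp: irreducible_coxeter_def)
    then have "?goal \<or> (\<exists>us. us \<in> lists Q \<and> distinct us \<and> us \<noteq> [] \<and>
        successively (\<lambda>s t. s \<otimes> t \<noteq> t \<otimes> s) us \<and> hd us = k \<and> last us = t0)"
    proof (induction rule: rtrancl_induct)
      case base
      show ?case using True by (intro disjI2 exI[of _ "[k]"]) simp
    next
      case (step i j)
      have ij: "i \<in> I" "j \<in> I" "i \<otimes> j \<noteq> j \<otimes> i" using diagram_noncomm step.hyps(2) by auto
      show ?case
      proof (cases ?goal)
        case False
        then obtain us where us: "us \<in> lists Q" "distinct us" "us \<noteq> []"
            "successively (\<lambda>s t. s \<otimes> t \<noteq> t \<otimes> s) us" "hd us = k" "last us = i"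
          using step.IH by blast
        have "i \<in> Q" using us last_in_set[of us] by auto
        then have "j \<notin> Y" using ij by (auto simp: Q_def)
        have ext: "successively (\<lambda>s t. s \<otimes> t \<noteq> t \<otimes> s) (us @ [j])" "hd (us @ [j]) = k"
          using us ij by (auto simp: successively_append_iff)
        show ?thesis
        proof (cases "j \<in> Q")
          case False
          then have ?goal using us ext \<open>j \<notin> Y\<close> ij by blast
          then show ?thesis by blast
        next
          case True
          show ?thesis
          proof (cases "j \<in> set us")
            case False
            then show ?thesis using us ext True by (intro disjI2 exI[of _ "us @ [j]"]) auto
          next
            case True
            then obtain as bs where "us = (as @ [j]) @ bs" using split_list by fastforce
            then show ?thesis using us
              by (intro disjI2 exI[of _ "as @ [j]"]) (auto simp: successively_append_iff hd_append split: if_splits)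
          qed
        qed
      qed simp
    qed
    moreover have "t0 \<notin> Q" using t0 by (simp add: Q_def)
    moreover have False if "us \<in> lists Q" "us \<noteq> []" "last us = t0" for us
      using that \<open>t0 \<notin> Q\<close> last_in_set[of us] by auto
    ultimately show ?goal by blast
  qed
  then obtain us e where us: "us \<in> lists Q" and e: "e \<in> I" "e \<notin> Y" "e \<notin> Q" and dist: "distinct us"
    and path: "successively (\<lambda>s t. s \<otimes> t \<noteq> t \<otimes> s) (us @ [e])" and hd: "hd (us @ [e]) = k"
    by blast
  define x where "x = wd (us @ [e])"
  define Z where "Z = {t \<in> Y. e \<otimes> t = t \<otimes> e}"
  have Z: "Z \<subseteq> Y" "Z \<noteq> Y" "Z \<subseteq> I" using e Y by (auto simp: Z_def Q_def)
  have pI: "us @ [e] \<in> lists I" "us \<in> lists I" using us e by (auto simp: Q_def)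
  have pd: "distinct (us @ [e])" using dist us e by auto
  define P where "P = set (us @ [e])"
  have P: "P \<subseteq> I" "P \<inter> Y = {}" using us e by (auto simp: P_def Q_def)
  have xP: "x \<in> generate W P" unfolding x_def P_def using pI by (intro word_in_generate) auto
  have xc: "x \<in> carrier W" "wd us \<in> carrier W" using pI unfolding x_def by blast+
  have x_eq: "x = wd us \<otimes> e" using pI e unfolding x_def by simp
  have comm_us: "wd us \<otimes> t = t \<otimes> wd us" if t: "t \<in> Y" for t
  proof -
    have "t \<in> carrier W" using t Y by auto
    then show ?thesis using us
    proof (induction us rule: list.induct)
      case (Cons a us)
      have a: "a \<in> I" "a \<otimes> t = t \<otimes> a" "us \<in> lists I" using Cons.prems t by (auto simp: Q_def)
      have IH: "wd us \<otimes> t = t \<otimes> wd us" using Cons by simp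
      have "a \<otimes> wd us \<otimes> t = a \<otimes> t \<otimes> wd us"
        using a(1) IH Cons.prems(1) wd_closed[OF a(3)] by (simp add: m_assoc)
      also have "\<dots> = t \<otimes> (a \<otimes> wd us)"
        unfolding a(2) using a(1) Cons.prems(1) wd_closed[OF a(3)] by (simp add: m_assoc)
      finally show ?case by simp
    qed simp
  qed
  have comm_x: "x \<otimes> t = t \<otimes> x" if t: "t \<in> Z" for t
  proof -
    have t': "t \<in> Y" "t \<in> carrier W" "e \<otimes> t = t \<otimes> e" using t Y by (auto simp: Z_def)
    then have "x \<otimes> t = wd us \<otimes> (t \<otimes> e)" using x_eq xc e by (simp add: m_assoc)
    also have "\<dots> = (wd us \<otimes> t) \<otimes> e" using t' xc e by (simp add: m_assoc)
    also have "\<dots> = t \<otimes> x" using comm_us[OF t'(1)] x_eq xc e t' by (simp add: m_assoc)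
    finally show ?thesis .
  qed
  have comm_gen: "x \<otimes> n = n \<otimes> x" if n: "n \<in> generate W Z" for n
  proof -
    obtain vs where vs: "vs \<in> lists Z" "wd vs = n" using generate_reduced_word[OF Z(3) n] by blast
    have "x \<otimes> wd vs = wd vs \<otimes> x" using vs(1)
    proof (induction vs rule: list.induct)
      case (Cons a vs)
      have a: "a \<in> I" "vs \<in> lists I" "x \<otimes> a = a \<otimes> x" using Cons.prems Z comm_x by auto
      have "x \<otimes> (a \<otimes> wd vs) = (x \<otimes> a) \<otimes> wd vs" using a(1) xc(1) wd_closed[OF a(2)] by (simp add: m_assoc)
      also have "\<dots> = a \<otimes> (x \<otimes> wd vs)" using a(1,3) xc(1) wd_closed[OF a(2)] by (simp add: m_assoc)
      also have "\<dots> = (a \<otimes> wd vs) \<otimes> x" using a(1) xc(1) wd_closed[OF a(2)] Cons by (simp add: m_assoc)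
      finally show ?case by simp
    qed (use xc in simp)
    then show ?thesis using vs by simp
  qed
  \<comment> \<open>Among the walls of the generators, \<open>x\<close> crosses only that of \<open>k\<close>; any other one that is crossed by
    \<open>x z\<close> is crossed by the part \<open>z\<close>.\<close>
  have descent: "s \<in> Z \<and> sep z s"
    if z: "z \<in> generate W Y" and s: "s \<in> I - {k}" and sep: "sep (x \<otimes> z) s" for z s
  proof -
    have zc: "z \<in> carrier W" using generate_closed[OF Y(1) z] .
    let ?r = "inv x \<otimes> s \<otimes> x"
    have sc: "s \<in> carrier W" "s \<in> I" using s by auto
    have "\<not> sep x s"
      using descent_of_path[of "us @ [e]" s] pI pd path hd s by (auto simp: x_def)
    then have r: "sep z ?r" using sep sep_mult[of x z s] xc zc sc by simp
    obtain vs where "vs \<in> lists Y" "wd vs = z" using generate_reduced_word[OF Y(1) z] by blast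
    then have rY: "?r \<in> generate W Y" using sep_delete(2)[of vs Y ?r] Y(1) r xc sc by simp
    have rP: "?r \<in> generate W (insert s P)"
    proof -
      have "x \<in> generate W (insert s P)" using xP mono_generate[of P "insert s P"] by blast
      moreover have "s \<in> generate W (insert s P)" by (simp add: generate.incl)
      moreover have "inv x \<in> generate W (insert s P)"
        using calculation(1) generate_inv[of "insert s P" x] P sc by simp
      ultimately show ?thesis using generate_mult by blast
    qed
    have sY: "s \<in> Y"
    proof (rule ccontr)
      assume "s \<notin> Y"
      then have "Y \<inter> insert s P = {}" using P by auto
      then have "?r = \<one>" using generate_Int[OF Y(1) _ rY rP] P sc generate_empty by simp
      then have "s = \<one>" using conj_eq_iff[of x s \<one>] xc sc by simp
      then show False using gen_neq_one sc by blast
    qed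
    have "inv x = e \<otimes> inv (wd us)" using x_eq xc e by (simp add: inv_mult_group)
    then have "?r = e \<otimes> (inv (wd us) \<otimes> (s \<otimes> wd us)) \<otimes> e"
      using x_eq xc e sc by (simp add: m_assoc)
    also have "s \<otimes> wd us = wd us \<otimes> s" using comm_us[OF sY] by simp
    finally have "?r = e \<otimes> s \<otimes> e" using xc sc by simp
    then have es: "e \<otimes> s = s \<otimes> e" using comm_of_conj[of e Y s] e Y sc rY by simp
    then have "?r = s" using \<open>?r = e \<otimes> s \<otimes> e\<close> e sc by (simp add: m_assoc)
    then show ?thesis using r sY es by (simp add: Z_def)
  qed
  \<comment> \<open>The left factors of \<open>y\<close> in the parabolic subgroup of \<open>Z\<close>; one of maximal length is split off.\<close>
  define D where "D = {n \<in> generate W Z. len n + len (inv n \<otimes> y) = len y}"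
  have "\<one> \<in> D" using yc by (simp add: D_def generate.one)
  moreover have "len n \<le> len y" if "n \<in> D" for n using that by (simp add: D_def)
  ultimately obtain n where n: "n \<in> D" and nmax: "\<And>m. m \<in> D \<Longrightarrow> len m \<le> len n"
    using ex_has_greatest_nat[of "\<lambda>n. n \<in> D" \<one> len "Suc (len y)"] by (auto simp: less_Suc_eq_le)
  have nZ: "n \<in> generate W Z" and nlen: "len n + len (inv n \<otimes> y) = len y" using n by (auto simp: D_def)
  have nc: "n \<in> carrier W" using generate_closed[OF Z(3) nZ] .
  let ?r1 = "inv n \<otimes> y"
  have r1c: "?r1 \<in> carrier W" using nc yc by simp
  have nY: "n \<in> generate W Y" using nZ mono_generate[OF Z(1)] by blast
  have r1Y: "?r1 \<in> generate W Y" using generate_mult generate_inv[OF Y(1) nY] Y(3) by blast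
  have r1Z: "\<not> sep ?r1 s" if s: "s \<in> Z" for s
  proof
    assume "sep ?r1 s"
    then have less: "len (s \<otimes> ?r1) < len ?r1" using sep_gen_iff[of s ?r1] s Z r1c by blast
    have sI: "s \<in> I" using s Z by blast
    have eq: "inv (n \<otimes> s) \<otimes> y = s \<otimes> ?r1" using nc yc sI by (simp add: inv_mult_group m_assoc)
    have "len y \<le> len (n \<otimes> s) + len (s \<otimes> ?r1)"
      using len_mult_le[of "n \<otimes> s" "s \<otimes> ?r1"] nc yc sI by (simp add: m_assoc)
    moreover have "len (n \<otimes> s) \<le> Suc (len n)" using len_mult_le[of n s] nc sI by simp
    ultimately have "len (n \<otimes> s) = Suc (len n)" "len (n \<otimes> s) + len (s \<otimes> ?r1) = len y"
      using less nlen by auto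
    moreover have "n \<otimes> s \<in> generate W Z"
      using nZ s by (intro generate_mult) (auto intro: generate.incl)
    ultimately have "n \<otimes> s \<in> D" using eq by (simp add: D_def)
    then show False using nmax[of "n \<otimes> s"] \<open>len (n \<otimes> s) = Suc (len n)\<close> by simp
  qed
  have "n \<noteq> y"
  proof
    assume "n = y"
    then have "supp y \<subseteq> Z" using nZ generate_iff_supp[OF Z(3)] by blast
    then show False using Z by (simp add: Y_def)
  qed
  then have "?r1 \<noteq> \<one>" using nc yc by (metis inv_solve_left one_closed r_one)
  then have less: "len n < len y" using nlen len_eq_0_iff[OF r1c] by simp
  have "x \<otimes> y = x \<otimes> (n \<otimes> ?r1)" using nc yc by simp
  also have "\<dots> = (x \<otimes> n) \<otimes> ?r1" using xc nc r1c by (simp add: m_assoc)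
  also have "\<dots> = n \<otimes> (x \<otimes> ?r1)" using comm_gen[OF nZ] xc nc r1c by (simp add: m_assoc)
  finally have eq: "x \<otimes> y = n \<otimes> (x \<otimes> ?r1)" .
  have "len (x \<otimes> y) = len x + len y"
    using len_mult_disjoint[OF P(1) Y(1) P(2) Y(3) xP] .
  moreover have "n \<in> generate W (I - {k})" using nY mono_generate[of Y "I - {k}"] Y by blast
  moreover have "len (s \<otimes> (x \<otimes> ?r1)) = Suc (len (x \<otimes> ?r1))" if s: "s \<in> I - {k}" for s
    using descent[OF r1Y s] r1Z len_not_sep[of s "x \<otimes> ?r1"] s xc r1c by blast
  ultimately show ?thesis using eq less xc(1) m_closed[OF xc(1) r1c] by blast
qed

section \<open>The Coxeter complex\<close>

text \<open>
  The chamber of the Coxeter complex that corresponds to \<open>w\<close>. Two chambers share their vertex of type \<open>i\<close>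
  exactly if \<open>i\<close> is not in the support of the quotient of the two group elements, so supports describe
  the common face of two chambers.
\<close>

definition cell :: "'a \<Rightarrow> ('a \<times> 'a set) set" where
  "cell w = (\<lambda>i. (i, w <# generate W (I - {i}))) ` I"

lemma coset_eq_iff:
  assumes "w \<in> carrier W" "v \<in> carrier W" "i \<in> I"
  shows "w <# generate W (I - {i}) = v <# generate W (I - {i}) \<longleftrightarrow> i \<notin> supp (inv w \<otimes> v)"
proof
  let ?H = "generate W (I - {i})"
  have H: "subgroup ?H W" using gen_subset by (intro generate_is_subgroup) auto
  have iff: "inv w \<otimes> v \<in> ?H \<longleftrightarrow> i \<notin> supp (inv w \<otimes> v)"
    using generate_iff_supp[of "I - {i}" "inv w \<otimes> v"] supp_subset[of "inv w \<otimes> v"] assms by auto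
  {
    assume "w <# ?H = v <# ?H"
    moreover have "v \<otimes> \<one> \<in> v <# ?H"
      using generate.one[of W "I - {i}"] unfolding l_coset_def by blast
    then have "v \<in> v <# ?H" using assms by simp
    ultimately have "v \<in> w <# ?H" by simp
    then obtain h where h: "h \<in> ?H" "v = w \<otimes> h" unfolding l_coset_def by blast
    moreover have "h \<in> carrier W" using subgroup.mem_carrier[OF H h(1)] .
    ultimately have "inv w \<otimes> v \<in> ?H" using assms by simp
    then show "i \<notin> supp (inv w \<otimes> v)" using iff by blast
  }
  assume "i \<notin> supp (inv w \<otimes> v)"
  then have "inv w \<otimes> v \<in> ?H" using iff by blast
  moreover have "v = w \<otimes> (inv w \<otimes> v)" using assms by simp
  ultimately have "v \<in> w <# ?H" unfolding l_coset_def by blast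
  then show "w <# ?H = v <# ?H" using l_repr_independence H assms by blast
qed

lemma cell_Int:
  assumes "w \<in> carrier W" "v \<in> carrier W"
  shows "fst ` (cell w \<inter> cell v) = I - supp (inv w \<otimes> v)"
proof -
  have "i \<in> fst ` (cell w \<inter> cell v) \<longleftrightarrow> i \<in> I \<and> w <# generate W (I - {i}) = v <# generate W (I - {i})" for i
    by (force simp: cell_def)
  then show ?thesis using coset_eq_iff[OF assms] by blast
qed

lemma fst_cell: "fst ` cell w = I"
  by (force simp: cell_def)

lemma cell_eq_iff:
  assumes "w \<in> carrier W" "v \<in> carrier W"
  shows "cell w = cell v \<longleftrightarrow> w = v"
proof
  assume "cell w = cell v"
  then have "I - supp (inv w \<otimes> v) = I" using cell_Int[OF assms] fst_cell by simp
  then have "supp (inv w \<otimes> v) = {}" using supp_subset by blast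
  then have "inv w \<otimes> v = \<one>" using supp_empty_iff assms by simp
  then show "w = v" using assms by (metis inv_solve_left one_closed r_one)
qed simp

lemma cell_in_complex: "w \<in> carrier W \<Longrightarrow> cell w \<in> coxeter_complex W I"
  unfolding coxeter_complex_def cell_def by blast

lemma in_complex_cell:
  assumes "R \<in> coxeter_complex W I"
  shows "\<exists>w\<in>carrier W. R \<subseteq> cell w \<and> (fst ` R = I \<longrightarrow> R = cell w)"
proof -
  obtain w J where w: "w \<in> carrier W" "J \<subseteq> I" "R = (\<lambda>i. (i, w <# generate W (I - {i}))) ` J"
    using assms unfolding coxeter_complex_def by auto
  have "fst ` R = J" unfolding w(3) by (simp add: image_image)
  moreover have "R \<subseteq> cell w" unfolding w(3) cell_def using w(2) by (rule image_mono)
  ultimately show ?thesis using w(1,3) unfolding cell_def by auto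
qed

lemma inj_fst_cell: "inj_on fst (cell w)"
  by (auto simp: cell_def inj_on_def)

end

section \<open>Longest elements\<close>

locale finite_coxeter = coxeter +
  assumes finite_carrier: "finite (carrier W)"
begin

lemma descents_exist:
  assumes J: "J \<subseteq> I"
  shows "\<exists>w\<in>generate W J. \<forall>s\<in>J. len (s \<otimes> w) < len w"
proof -
  have fin': "finite (generate W J)"
    using finite_carrier generate_closed[OF J] by (rule_tac finite_subset[of _ "carrier W"]) auto
  then have "Max (len ` generate W J) \<in> len ` generate W J"
    using generate.one[of W J] fin' by (intro Max_in) auto
  then obtain w where w: "w \<in> generate W J" "len w = Max (len ` generate W J)" by auto
  have wmax: "len v \<le> len w" if "v \<in> generate W J" for v
    unfolding w(2) using that fin' by (intro Max_ge) auto
  have "len (s \<otimes> w) < len w" if s: "s \<in> J" for s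
  proof -
    have "s \<otimes> w \<in> generate W J" using s w by (intro generate_mult) (auto intro: generate.incl)
    then have "len (s \<otimes> w) \<le> len w" by (rule wmax)
    then show ?thesis using len_gen_cases[of s w] s J w generate_closed[OF J] by force
  qed
  then show ?thesis using w by blast
qed

definition longest :: "'a set \<Rightarrow> 'a" where
  "longest J = (SOME w. w \<in> generate W J \<and> (\<forall>s\<in>J. len (s \<otimes> w) < len w))"

lemma longest:
  assumes "J \<subseteq> I"
  shows "longest J \<in> generate W J" "\<And>s. s \<in> J \<Longrightarrow> len (s \<otimes> longest J) < len (longest J)"
proof -
  have "longest J \<in> generate W J \<and> (\<forall>s\<in>J. len (s \<otimes> longest J) < len (longest J))"
    unfolding longest_def by (rule someI_ex) (use descents_exist[OF assms] in blast)
  then show "longest J \<in> generate W J" "\<And>s. s \<in> J \<Longrightarrow> len (s \<otimes> longest J) < len (longest J)" by auto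
qed

lemma longest_closed [simp]: "J \<subseteq> I \<Longrightarrow> longest J \<in> carrier W"
  using longest(1) generate_closed by blast

lemma len_mult_longest:
  assumes "J \<subseteq> I" "m \<in> generate W J"
  shows "len (m \<otimes> longest J) + len m = len (longest J)"
  using coset_maximal[OF assms(1) _ longest(2)[OF assms(1)] assms(2)] assms by simp

lemma longest_sq [simp]: "J \<subseteq> I \<Longrightarrow> longest J \<otimes> longest J = \<one>"
  using len_mult_longest[of J "longest J"] longest(1)[of J] by simp

lemma longest_inv [simp]: "J \<subseteq> I \<Longrightarrow> inv (longest J) = longest J"
  by (simp add: inv_equality)

lemma len_longest_mult:
  assumes "J \<subseteq> I" "m \<in> generate W J"
  shows "len (longest J \<otimes> m) + len m = len (longest J)"
proof -
  have m: "m \<in> carrier W" using generate_closed assms by blast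
  have "longest J \<otimes> m = inv (inv m \<otimes> longest J)" using assms m by (simp add: inv_mult_group)
  then have "len (longest J \<otimes> m) = len (inv m \<otimes> longest J)"
    using assms m len_inv[of "inv m \<otimes> longest J"] by simp
  then show ?thesis using len_mult_longest[OF assms(1) generate_inv[OF assms]] m by simp
qed

abbreviation w0 :: 'a where "w0 \<equiv> longest I"

lemma w0_closed [simp, intro]: "w0 \<in> carrier W"
  by simp

lemma w0_cancel [simp]: "w \<in> carrier W \<Longrightarrow> w0 \<otimes> (w0 \<otimes> w) = w"
  by (simp flip: m_assoc)

lemma len_mult_w0: "w \<in> carrier W \<Longrightarrow> len (w \<otimes> w0) + len w = len w0"
  using len_mult_longest[of I w] generate_gens by simp

lemma len_w0_mult: "w \<in> carrier W \<Longrightarrow> len (w0 \<otimes> w) + len w = len w0"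
  using len_longest_mult[of I w] generate_gens by simp

lemma all_descents_w0:
  assumes u: "u \<in> carrier W" and desc: "\<And>s. s \<in> I \<Longrightarrow> len (u \<otimes> s) < len u"
  shows "u = w0"
proof -
  have "len (s \<otimes> inv u) < len (inv u)" if s: "s \<in> I" for s
  proof -
    have "s \<otimes> inv u = inv (u \<otimes> s)" using s u by (simp add: inv_mult_group)
    then show ?thesis using desc[OF s] s u by simp
  qed
  then have "len (w0 \<otimes> inv u) + len w0 = len (inv u)"
    using coset_maximal[of I "inv u" w0] u generate_gens by simp
  then have "len (w0 \<otimes> inv u) = 0" using len_w0_mult[of "inv u"] u by (simp del: len_eq_0_iff)
  then have "w0 \<otimes> inv u = \<one>" using u len_eq_0_iff[of "w0 \<otimes> inv u"] by (simp del: len_eq_0_iff)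
  then show ?thesis using u by (metis inv_closed inv_equality inv_inv w0_closed)
qed

lemma w0_conj_gen:
  assumes "s \<in> I"
  shows "w0 \<otimes> s \<otimes> w0 \<in> I"
proof -
  have "len (s \<otimes> w0) + 1 = len w0" using len_mult_w0[of s] assms by simp
  then have "len (w0 \<otimes> (s \<otimes> w0)) = 1" using len_w0_mult[of "s \<otimes> w0"] assms by simp
  then show ?thesis using len_eq_1_iff[of "w0 \<otimes> (s \<otimes> w0)"] assms by (simp add: m_assoc)
qed

lemma w0_conj_generate:
  assumes A: "A \<subseteq> I" "w \<in> generate W A"
  shows "w0 \<otimes> w \<otimes> w0 \<in> generate W ((\<lambda>s. w0 \<otimes> s \<otimes> w0) ` A)" (is "_ \<in> generate W ?B")
proof -
  obtain us where us: "us \<in> lists A" "wd us = w" using generate_reduced_word[OF A] by blast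
  have "w0 \<otimes> wd us \<otimes> w0 \<in> generate W ?B"
    using us(1)
  proof (induction us rule: list.induct)
    case (Cons s us)
    have s: "s \<in> A" "s \<in> carrier W" "us \<in> lists I" using Cons.prems A by auto
    have "w0 \<otimes> wd (s # us) \<otimes> w0 = (w0 \<otimes> s \<otimes> w0) \<otimes> (w0 \<otimes> wd us \<otimes> w0)"
      using s wd_closed[of us] by (simp add: m_assoc)
    moreover have "w0 \<otimes> s \<otimes> w0 \<in> generate W ?B" using s by (intro generate.incl) auto
    ultimately show ?case using Cons generate_mult[of "w0 \<otimes> s \<otimes> w0" ?B] by simp
  qed (simp add: generate.one)
  then show ?thesis using us by simp
qed

end

section \<open>The Weyl distance\<close>

locale spherical = finite_coxeter W I for W (structure) and I +
  fixes \<Delta> :: "'v set set" and \<tau> :: "'v \<Rightarrow> 'a" and \<A> :: "'v set set set"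
  assumes building: "building W I \<Delta> \<tau> \<A>"
begin

abbreviation Ch :: "'v set \<Rightarrow> bool" where "Ch \<equiv> chamber I \<Delta> \<tau>"

definition chart :: "'v set set \<Rightarrow> ('v \<Rightarrow> 'a \<times> 'a set) \<Rightarrow> bool" where
  "chart A \<phi> \<longleftrightarrow> A \<in> \<A> \<and> typed_iso \<tau> A fst (coxeter_complex W I) \<phi>"

lemma building_parts:
  "simplicial_complex \<Delta>"
  "\<forall>A\<in>\<A>. subcomplex \<Delta> A \<and> (\<exists>\<phi>. typed_iso \<tau> A fst (coxeter_complex W I) \<phi>)"
  "\<forall>R\<in>\<Delta>. \<forall>S\<in>\<Delta>. \<exists>A\<in>\<A>. R \<in> A \<and> S \<in> A"
  "\<forall>A\<in>\<A>. \<forall>A'\<in>\<A>. \<forall>R\<in>A \<inter> A'. \<forall>S\<in>A \<inter> A'.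
      \<exists>\<phi>. typed_iso \<tau> A \<tau> A' \<phi> \<and> (\<forall>v\<in>R \<union> S. \<phi> v = v)"
proof -
  note b = building[unfolded building_def]
  show "simplicial_complex \<Delta>"
    using b by (elim conjE)
  show "\<forall>A\<in>\<A>. subcomplex \<Delta> A \<and> (\<exists>\<phi>. typed_iso \<tau> A fst (coxeter_complex W I) \<phi>)"
    using b by (elim conjE)
  show "\<forall>R\<in>\<Delta>. \<forall>S\<in>\<Delta>. \<exists>A\<in>\<A>. R \<in> A \<and> S \<in> A"
    using b by (elim conjE)
  show "\<forall>A\<in>\<A>. \<forall>A'\<in>\<A>. \<forall>R\<in>A \<inter> A'. \<forall>S\<in>A \<inter> A'.
      \<exists>\<phi>. typed_iso \<tau> A \<tau> A' \<phi> \<and> (\<forall>v\<in>R \<union> S. \<phi> v = v)"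
    using b by (elim conjE)
qed

lemma apartment_subset: "A \<in> \<A> \<Longrightarrow> A \<subseteq> \<Delta>"
  using building_parts(2) by (simp add: subcomplex_def)

lemma apartment_face: "\<lbrakk>A \<in> \<A>; R \<in> A; S \<subseteq> R\<rbrakk> \<Longrightarrow> S \<in> A"
  using building_parts(2) by (simp add: subcomplex_def)

lemma apartment_chart: "A \<in> \<A> \<Longrightarrow> \<exists>\<phi>. chart A \<phi>"
  using building_parts(2) by (simp add: chart_def)

lemma common_apartment: "\<lbrakk>R \<in> \<Delta>; S \<in> \<Delta>\<rbrakk> \<Longrightarrow> \<exists>A\<in>\<A>. R \<in> A \<and> S \<in> A"
  using building_parts(3) by blast

lemma apartment_iso: "\<lbrakk>A \<in> \<A>; A' \<in> \<A>; R \<in> A; R \<in> A'; S \<in> A; S \<in> A'\<rbrakk> \<Longrightarrow>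
    \<exists>\<psi>. typed_iso \<tau> A \<tau> A' \<psi> \<and> (\<forall>v\<in>R \<union> S. \<psi> v = v)"
  using building_parts(4) by blast

lemma complex_face: "\<lbrakk>R \<in> \<Delta>; S \<subseteq> R\<rbrakk> \<Longrightarrow> S \<in> \<Delta>"
  using building_parts(1) unfolding simplicial_complex_def by blast

lemma chartD:
  assumes "chart A \<phi>"
  shows "A \<in> \<A>" "bij_betw \<phi> (\<Union>A) (\<Union>(coxeter_complex W I))"
    "(\<lambda>R. \<phi> ` R) ` A = coxeter_complex W I" "\<And>v. v \<in> \<Union>A \<Longrightarrow> fst (\<phi> v) = \<tau> v"
proof -
  note c = assms[unfolded chart_def typed_iso_def]
  show "A \<in> \<A>" "bij_betw \<phi> (\<Union>A) (\<Union>(coxeter_complex W I))"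
    "(\<lambda>R. \<phi> ` R) ` A = coxeter_complex W I"
    using c by simp_all
  show "fst (\<phi> v) = \<tau> v" if "v \<in> \<Union>A" for v
    using c that by (elim conjE) (rule bspec)
qed

lemma chart_in_complex: "\<lbrakk>chart A \<phi>; X \<in> A\<rbrakk> \<Longrightarrow> \<phi> ` X \<in> coxeter_complex W I"
  using chartD(3) by blast

lemma chart_types:
  assumes "chart A \<phi>" "X \<subseteq> \<Union>A"
  shows "fst ` \<phi> ` X = \<tau> ` X"
  unfolding image_image by (rule image_cong) (use chartD(4)[OF assms(1)] assms(2) in blast)+

lemma inj_on_image_subsetD: "\<lbrakk>inj_on f C; A \<subseteq> C; B \<subseteq> C; f ` A \<subseteq> f ` B\<rbrakk> \<Longrightarrow> A \<subseteq> B"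
  by (metis image_subset_iff inj_on_image_mem_iff subset_eq)

lemma chart_inj: "chart A \<phi> \<Longrightarrow> inj_on \<phi> (\<Union>A)"
  using chartD(2) bij_betw_imp_inj_on by blast

lemma chart_cell: "\<lbrakk>chart A \<phi>; X \<in> A; Ch X\<rbrakk> \<Longrightarrow> \<exists>w\<in>carrier W. \<phi> ` X = cell w"
  using in_complex_cell[OF chart_in_complex] chart_types[of A \<phi> X]
  by (metis Union_upper chamber_def)

lemma chart_chamber:
  assumes "chart A \<phi>" "w \<in> carrier W"
  shows "\<exists>X\<in>A. Ch X \<and> \<phi> ` X = cell w"
proof -
  obtain X where X: "X \<in> A" "\<phi> ` X = cell w"
    using cell_in_complex[OF assms(2)] unfolding chartD(3)[OF assms(1), symmetric] by blast
  then have "\<tau> ` X = I" using chart_types[OF assms(1), of X] fst_cell[of w] by (simp add: Union_upper)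
  moreover have "X \<in> \<Delta>" using X apartment_subset assms(1) unfolding chart_def by blast
  ultimately show ?thesis using X by (auto simp: chamber_def)
qed

lemma chart_Int:
  assumes c: "chart A \<phi>" and X: "X \<in> A" "Y \<in> A" and a: "a \<in> carrier W" "b \<in> carrier W"
    and eq: "\<phi> ` X = cell a" "\<phi> ` Y = cell b"
  shows "\<tau> ` (X \<inter> Y) = I - supp (inv a \<otimes> b)"
proof -
  have "\<phi> ` (X \<inter> Y) = cell a \<inter> cell b"
    using inj_on_image_Int[OF chart_inj[OF c], of X Y] X eq by (simp add: Union_upper)
  then have "fst ` \<phi> ` (X \<inter> Y) = I - supp (inv a \<otimes> b)" using cell_Int a by simp
  moreover have "X \<inter> Y \<subseteq> \<Union>A" using X by blast
  ultimately show ?thesis using chart_types[OF c] by simp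
qed

lemma chart_image_inj: "\<lbrakk>chart A \<phi>; X \<in> A; Y \<in> A; \<phi> ` X = \<phi> ` Y\<rbrakk> \<Longrightarrow> X = Y"
  using inj_on_image_eq_iff[OF chart_inj] by (metis Union_upper)

text \<open>
  Charts preserve the types of common faces, hence \<open>s\<close>-adjacency of chambers. So the transition between two
  charts commutes with right multiplication by generators, that is, it is a left multiplication.
\<close>

lemma chart_position_unique:
  assumes c: "chart A \<phi>" "chart A \<psi>" and X: "X \<in> A" "Y \<in> A" "Ch X" "Ch Y"
    and a: "a \<in> carrier W" "b \<in> carrier W" "c \<in> carrier W" "d \<in> carrier W"
    and eq: "\<phi> ` X = cell a" "\<phi> ` Y = cell b" "\<psi> ` X = cell c" "\<psi> ` Y = cell d"
  shows "inv a \<otimes> b = inv c \<otimes> d"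
proof -
  have *: "d = c \<otimes> wd us" if "us \<in> lists I" "b = a \<otimes> wd us" for us
    using that X(1,3) a(1,3) eq(1,3)
  proof (induction us arbitrary: X a c rule: list.induct)
    case Nil
    then have "\<phi> ` X = \<phi> ` Y" using eq by simp
    then have "X = Y" using chart_image_inj[OF c(1)] Nil X by blast
    then have "cell c = cell d" using eq Nil by simp
    then show ?case using cell_eq_iff Nil a by simp
  next
    case (Cons s us)
    have s: "s \<in> I" "us \<in> lists I" using Cons.prems(1) by auto
    have us: "wd us \<in> carrier W" using s by blast
    obtain Z where Z: "Z \<in> A" "Ch Z" "\<phi> ` Z = cell (a \<otimes> s)"
      using chart_chamber[OF c(1), of "a \<otimes> s"] s Cons.prems by auto
    obtain e where e: "e \<in> carrier W" "\<psi> ` Z = cell e" using chart_cell[OF c(2) Z(1,2)] by blast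
    have "I - supp (inv a \<otimes> (a \<otimes> s)) = I - supp (inv c \<otimes> e)"
      using chart_Int[OF c(1) Cons.prems(3) Z(1), of a "a \<otimes> s"]
        chart_Int[OF c(2) Cons.prems(3) Z(1), of c e] Cons.prems Z e s by simp
    then have "supp (inv c \<otimes> e) = supp (inv a \<otimes> (a \<otimes> s))" using supp_subset by blast
    also have "\<dots> = {s}" using s Cons.prems(5) by simp
    finally have "inv c \<otimes> e = s" using supp_singleton_iff s e Cons.prems by simp
    then have ce: "e = c \<otimes> s" using e Cons.prems(6) by (metis cancel_inv(1))
    have "b = (a \<otimes> s) \<otimes> wd us" using Cons.prems s us by (simp add: m_assoc)
    then have "d = e \<otimes> wd us"
      using Cons.IH[OF s(2) _ Z(1,2)] Cons.prems s e Z by simp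
    then show ?case using ce Cons.prems(6) s us by (simp add: m_assoc)
  qed
  obtain us where us: "us \<in> lists I" "wd us = inv a \<otimes> b"
    using carrier_words[of "inv a \<otimes> b"] a by auto
  then have "d = c \<otimes> (inv a \<otimes> b)" using *[of us] a by simp
  then show ?thesis using a by simp
qed

lemma chart_comp:
  assumes "typed_iso \<tau> A \<tau> A' \<psi>" "chart A' \<phi>" "A \<in> \<A>"
  shows "chart A (\<phi> \<circ> \<psi>)"
proof -
  have p: "bij_betw \<psi> (\<Union>A) (\<Union>A')" "(\<lambda>R. \<psi> ` R) ` A = A'" "\<forall>v\<in>\<Union>A. \<tau> (\<psi> v) = \<tau> v"
    using assms(1) unfolding typed_iso_def by simp_all
  note f = chartD[OF assms(2)]
  have "(\<lambda>R. (\<phi> \<circ> \<psi>) ` R) ` A = (\<lambda>R. \<phi> ` R) ` (\<lambda>R. \<psi> ` R) ` A"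
    by (simp only: image_comp comp_def)
  then have "(\<lambda>R. (\<phi> \<circ> \<psi>) ` R) ` A = coxeter_complex W I"
    using p(2) f(3) by simp
  moreover have "fst ((\<phi> \<circ> \<psi>) v) = \<tau> v" if "v \<in> \<Union>A" for v
  proof -
    have "\<psi> v \<in> \<Union>A'" using bij_betwE[OF p(1)] that by (rule bspec)
    then have "fst (\<phi> (\<psi> v)) = \<tau> (\<psi> v)" by (rule f(4))
    also have "\<dots> = \<tau> v" using p(3) that by (rule bspec)
    finally show ?thesis by simp
  qed
  ultimately show ?thesis
    using bij_betw_trans[OF p(1) f(2)] assms(3) by (simp add: chart_def typed_iso_def)
qed

definition pos :: "'v set \<Rightarrow> 'v set \<Rightarrow> 'a \<Rightarrow> bool" where
  "pos C D w \<longleftrightarrow> (\<exists>A \<phi> a b. chart A \<phi> \<and> C \<in> A \<and> D \<in> A \<and> a \<in> carrier W \<and> b \<in> carrier W \<and>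
     \<phi> ` C = cell a \<and> \<phi> ` D = cell b \<and> w = inv a \<otimes> b)"

lemma pos_unique:
  assumes "pos C D w" "pos C D w'" "Ch C" "Ch D"
  shows "w = w'"
proof -
  obtain A \<phi> a b where 1: "chart A \<phi>" "C \<in> A" "D \<in> A" "a \<in> carrier W" "b \<in> carrier W"
     "\<phi> ` C = cell a" "\<phi> ` D = cell b" "w = inv a \<otimes> b"
    using assms(1) unfolding pos_def by blast
  obtain A' \<phi>' a' b' where 2: "chart A' \<phi>'" "C \<in> A'" "D \<in> A'" "a' \<in> carrier W" "b' \<in> carrier W"
     "\<phi>' ` C = cell a'" "\<phi>' ` D = cell b'" "w' = inv a' \<otimes> b'"
    using assms(2) unfolding pos_def by blast
  obtain \<psi> where \<psi>: "typed_iso \<tau> A \<tau> A' \<psi>" "\<forall>v\<in>C \<union> D. \<psi> v = v"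
    using apartment_iso[of A A' C D] 1 2 unfolding chart_def by blast
  then have ch: "chart A (\<phi>' \<circ> \<psi>)" using chart_comp 1 2 unfolding chart_def by blast
  have "\<psi> ` C = C" "\<psi> ` D = D" using \<psi>(2) by force+
  then have "(\<phi>' \<circ> \<psi>) ` C = cell a'" "(\<phi>' \<circ> \<psi>) ` D = cell b'" using 2 by (simp_all flip: image_image add: image_comp[symmetric])
  then show ?thesis
    using chart_position_unique[OF 1(1) ch 1(2,3) assms(3,4) 1(4,5) 2(4,5) 1(6,7)] 1(8) 2(8) by simp
qed

text \<open>
  The Weyl distance is read off in any apartment that contains both chambers. By \<open>pos_unique\<close> neither
  the apartment nor its chart matters, which makes the description unique.
\<close>

definition \<delta> :: "'v set \<Rightarrow> 'v set \<Rightarrow> 'a" where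
  "\<delta> C D = (THE w. pos C D w)"

lemma \<delta>_chart:
  assumes "chart A \<phi>" "C \<in> A" "D \<in> A" "Ch C" "Ch D" "a \<in> carrier W" "b \<in> carrier W"
    "\<phi> ` C = cell a" "\<phi> ` D = cell b"
  shows "\<delta> C D = inv a \<otimes> b"
proof -
  have "pos C D (inv a \<otimes> b)" unfolding pos_def using assms by blast
  then show ?thesis unfolding \<delta>_def using pos_unique assms(4,5) by blast
qed

lemma chamber_simplex: "Ch C \<Longrightarrow> C \<in> \<Delta>"
  by (simp add: chamber_def)

lemma chambers_apartment: "\<lbrakk>Ch C; Ch D\<rbrakk> \<Longrightarrow> \<exists>A\<in>\<A>. C \<in> A \<and> D \<in> A"
  using common_apartment chamber_simplex by blast

lemma apartment_\<delta>_mult: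
  assumes "A \<in> \<A>" "X \<in> A" "Y \<in> A" "Z \<in> A" "Ch X" "Ch Y" "Ch Z"
  shows "\<delta> X Z = \<delta> X Y \<otimes> \<delta> Y Z" "\<delta> X Y \<in> carrier W" "\<tau> ` (X \<inter> Y) = I - supp (\<delta> X Y)"
proof -
  obtain \<phi> where c: "chart A \<phi>" using apartment_chart[OF assms(1)] by blast
  obtain x y z where w: "x \<in> carrier W" "y \<in> carrier W" "z \<in> carrier W"
    "\<phi> ` X = cell x" "\<phi> ` Y = cell y" "\<phi> ` Z = cell z"
    using chart_cell[OF c] assms by metis
  have d: "\<delta> X Y = inv x \<otimes> y" "\<delta> Y Z = inv y \<otimes> z" "\<delta> X Z = inv x \<otimes> z"
    using \<delta>_chart[OF c] assms w by auto
  then show "\<delta> X Z = \<delta> X Y \<otimes> \<delta> Y Z" using w by (simp add: m_assoc)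
  show "\<delta> X Y \<in> carrier W" using d w by simp
  show "\<tau> ` (X \<inter> Y) = I - supp (\<delta> X Y)" using chart_Int[OF c] assms w d by simp
qed

lemma \<delta>_closed [simp, intro]: "\<lbrakk>Ch C; Ch D\<rbrakk> \<Longrightarrow> \<delta> C D \<in> carrier W"
  using chambers_apartment apartment_\<delta>_mult(2) by meson

lemma \<delta>_Int: "\<lbrakk>Ch C; Ch D\<rbrakk> \<Longrightarrow> \<tau> ` (C \<inter> D) = I - supp (\<delta> C D)"
  using chambers_apartment apartment_\<delta>_mult(3) by meson

lemma \<delta>_self [simp]: "Ch C \<Longrightarrow> \<delta> C C = \<one>"
proof -
  assume C: "Ch C"
  then have "I - supp (\<delta> C C) = I" using \<delta>_Int[of C C] by (simp add: chamber_def)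
  then show ?thesis using supp_subset supp_empty_iff[of "\<delta> C C"] C by blast
qed

lemma \<delta>_inv:
  assumes "Ch C" "Ch D"
  shows "\<delta> D C = inv (\<delta> C D)"
proof -
  obtain A where A: "A \<in> \<A>" "C \<in> A" "D \<in> A" using chambers_apartment assms by blast
  then have "\<one> = \<delta> C D \<otimes> \<delta> D C" using apartment_\<delta>_mult(1)[of A C D C] assms by simp
  then show ?thesis using assms by (metis \<delta>_closed inv_char inv_comm inv_equality)
qed

lemma apartment_chamber:
  assumes "A \<in> \<A>" "X \<in> A" "Ch X" "w \<in> carrier W"
  shows "\<exists>Y\<in>A. Ch Y \<and> \<delta> X Y = w"
proof -
  obtain \<phi> where c: "chart A \<phi>" using apartment_chart[OF assms(1)] by blast
  obtain x where x: "x \<in> carrier W" "\<phi> ` X = cell x" using chart_cell[OF c] assms by blast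
  obtain Y where Y: "Y \<in> A" "Ch Y" "\<phi> ` Y = cell (x \<otimes> w)"
    using chart_chamber[OF c, of "x \<otimes> w"] x assms by auto
  have "\<delta> X Y = inv x \<otimes> (x \<otimes> w)"
    using \<delta>_chart[OF c assms(2) Y(1) assms(3) Y(2) x(1) _ x(2) Y(3)] x(1) assms(4) by simp
  then show ?thesis using Y(1,2) x(1) assms(4) by auto
qed

lemma typed_inj:
  assumes "R \<in> \<Delta>"
  shows "inj_on \<tau> R"
proof -
  obtain A where A: "A \<in> \<A>" "R \<in> A" using common_apartment assms by blast
  obtain \<phi> where c: "chart A \<phi>" using apartment_chart[OF A(1)] by blast
  obtain w where "\<phi> ` R \<subseteq> cell w" using in_complex_cell chart_in_complex[OF c A(2)] by blast
  then have "inj_on fst (\<phi> ` R)" using inj_fst_cell inj_on_subset by blast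
  moreover have "inj_on \<phi> R" using chart_inj[OF c] A inj_on_subset by blast
  ultimately have "inj_on (fst \<circ> \<phi>) R" by (rule comp_inj_on[rotated])
  moreover have "(fst \<circ> \<phi>) v = \<tau> v" if "v \<in> R" for v
    using chartD(4)[OF c] A that by auto
  ultimately show ?thesis using inj_on_cong[of R "fst \<circ> \<phi>" \<tau>] by blast
qed

lemma face_eq:
  assumes "R \<in> \<Delta>" "S \<subseteq> R" "T \<subseteq> R" "\<tau> ` S \<subseteq> \<tau> ` T"
  shows "S \<subseteq> T"
  using inj_on_image_subsetD[OF typed_inj[OF assms(1)] assms(2-4)] .

lemma chamber_subset_eq: "\<lbrakk>Ch C; Ch D; C \<subseteq> D\<rbrakk> \<Longrightarrow> C = D"
  using face_eq[of D D C] by (auto simp: chamber_def)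

lemma \<delta>_eq_one_iff: "\<lbrakk>Ch C; Ch D\<rbrakk> \<Longrightarrow> \<delta> C D = \<one> \<longleftrightarrow> C = D"
proof
  assume C: "Ch C" "Ch D" and "\<delta> C D = \<one>"
  then have "\<tau> ` C = \<tau> ` (C \<inter> D)" using \<delta>_Int[of C D] by (simp add: chamber_def)
  then have "C \<subseteq> C \<inter> D" using face_eq[of C C "C \<inter> D"] C by (simp add: chamber_def)
  then show "C = D" using chamber_subset_eq C by blast
qed simp

lemma apartment_face_of_chamber:
  assumes "A \<in> \<A>" "R \<in> A"
  shows "\<exists>C\<in>A. Ch C \<and> R \<subseteq> C"
proof -
  obtain \<phi> where c: "chart A \<phi>" using apartment_chart[OF assms(1)] by blast
  obtain w where w: "w \<in> carrier W" "\<phi> ` R \<subseteq> cell w"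
    using in_complex_cell chart_in_complex[OF c assms(2)] by blast
  obtain C where C: "C \<in> A" "Ch C" "\<phi> ` C = cell w" using chart_chamber[OF c w(1)] by blast
  have "R \<subseteq> C"
    using inj_on_image_subsetD[OF chart_inj[OF c], of R C] w(2) C(1,3) assms(2) by (simp add: Union_upper)
  then show ?thesis using C by blast
qed

text \<open>
  Map an apartment containing \<open>C\<close> and \<open>D\<close> to one containing \<open>C'\<close> and \<open>D\<close>, fixing \<open>D\<close> and the common panel
  of \<open>C\<close> and \<open>C'\<close>. The image of \<open>C\<close> has the same distance to \<open>D\<close> as \<open>C\<close> and contains the panel, so it is
  \<open>C'\<close> or its \<open>s\<close>-neighbour in the second apartment.
\<close>

lemma \<delta>_step:
  assumes ch: "Ch C" "Ch C'" "Ch D" and s: "\<delta> C C' = s" "s \<in> I"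
  shows "\<delta> C' D = \<delta> C D \<or> \<delta> C' D = s \<otimes> \<delta> C D"
proof -
  obtain A where A: "A \<in> \<A>" "C \<in> A" "D \<in> A" using chambers_apartment ch by blast
  obtain A' where A': "A' \<in> \<A>" "C' \<in> A'" "D \<in> A'" using chambers_apartment ch by blast
  have "C \<inter> C' \<in> A" "C \<inter> C' \<in> A'" using apartment_face A A' by (meson Int_lower1 Int_lower2)+
  then obtain \<psi> where \<psi>: "typed_iso \<tau> A \<tau> A' \<psi>" "\<forall>v\<in>(C \<inter> C') \<union> D. \<psi> v = v"
    using apartment_iso[of A A' "C \<inter> C'" D] A A' by blast
  obtain \<phi> where c: "chart A' \<phi>" using apartment_chart[OF A'(1)] by blast
  then have c': "chart A (\<phi> \<circ> \<psi>)" using chart_comp \<psi> A by blast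
  let ?X = "\<psi> ` C"
  have X: "?X \<in> A'" using \<psi>(1) A unfolding typed_iso_def by blast
  have "\<tau> ` ?X = \<tau> ` C" using \<psi>(1) A unfolding typed_iso_def by (force simp: image_image)
  then have ChX: "Ch ?X" using X apartment_subset[OF A'(1)] ch by (auto simp: chamber_def)
  have D: "\<psi> ` D = D" using \<psi>(2) by force
  obtain a b where ab: "a \<in> carrier W" "b \<in> carrier W" "\<phi> ` ?X = cell a" "\<phi> ` D = cell b"
    using chart_cell[OF c] X A' ChX ch by metis
  have "(\<phi> \<circ> \<psi>) ` C = cell a" using ab(3) by (simp only: image_comp)
  moreover have "(\<phi> \<circ> \<psi>) ` D = cell b" using ab(4) D by (metis image_comp)
  ultimately have "\<delta> C D = inv a \<otimes> b" using \<delta>_chart[OF c' A(2,3) ch(1,3) ab(1,2)] by blast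
  moreover have "\<delta> ?X D = inv a \<otimes> b" using \<delta>_chart[OF c X A'(3) ChX ch(3) ab] .
  ultimately have XD: "\<delta> ?X D = \<delta> C D" by simp
  have "C \<inter> C' \<subseteq> ?X \<inter> C'" using \<psi>(2) by force
  then have "I - {s} \<subseteq> \<tau> ` (?X \<inter> C')" using \<delta>_Int[of C C'] ch s by (metis image_mono supp_gen)
  then have "supp (\<delta> ?X C') \<subseteq> {s}" using \<delta>_Int[OF ChX ch(2)] supp_subset by blast
  then have "\<delta> ?X C' \<in> generate W {s}" using generate_iff_supp[of "{s}"] s ChX ch by simp
  then have "\<delta> ?X C' = \<one> \<or> \<delta> ?X C' = s" using generate_single s by blast
  then show ?thesis
  proof
    assume "\<delta> ?X C' = \<one>"
    then have "?X = C'" using \<delta>_eq_one_iff ChX ch by blast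
    then show ?thesis using XD by simp
  next
    assume "\<delta> ?X C' = s"
    then have "\<delta> C' ?X = s" using \<delta>_inv[OF ChX ch(2)] s by simp
    then show ?thesis using apartment_\<delta>_mult(1)[OF A'(1,2) X A'(3) ch(2) ChX ch(3)] XD by simp
  qed
qed

text \<open>
  Let \<open>v t\<close> be a reduced decomposition of \<open>\<delta>(C, D)\<close> with a last letter \<open>t\<close>, and \<open>E\<close> the chamber before \<open>D\<close>
  on a corresponding gallery. By induction \<open>\<delta>(C', E) = s v\<close>. The step from \<open>C\<close> to \<open>C'\<close> leaves \<open>v t\<close> and
  \<open>s v t\<close> as candidates for \<open>\<delta>(C', D)\<close>, the step from \<open>E\<close> to \<open>D\<close> leaves \<open>s v\<close> and \<open>s v t\<close>; the lengths
  exclude \<open>v t = s v\<close>.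
\<close>

lemma \<delta>_step_up:
  assumes ch: "Ch C" "Ch C'" and s: "\<delta> C C' = s" "s \<in> I"
    and D: "Ch D" "len (\<delta> C D) < len (s \<otimes> \<delta> C D)"
  shows "\<delta> C' D = s \<otimes> \<delta> C D"
  using D
proof (induction "len (\<delta> C D)" arbitrary: D rule: less_induct)
  case less
  let ?w = "\<delta> C D"
  have wc: "?w \<in> carrier W" using ch less.prems by blast
  show ?case
  proof (cases "?w = \<one>")
    case True
    then have "C = D" using \<delta>_eq_one_iff ch less.prems by blast
    then show ?thesis using \<delta>_inv[OF ch] s ch by simp
  next
    case False
    then obtain t v where t: "t \<in> I" "v \<in> carrier W" "?w = v \<otimes> t" "len ?w = Suc (len v)"
      using last_letter[OF wc] by blast
    obtain A where A: "A \<in> \<A>" "C \<in> A" "D \<in> A" using chambers_apartment ch less.prems by blast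
    obtain E where E: "E \<in> A" "Ch E" "\<delta> C E = v" using apartment_chamber[OF A(1,2) ch(1) t(2)] by blast
    have "v \<otimes> t = v \<otimes> \<delta> E D" using apartment_\<delta>_mult(1)[OF A(1,2) E(1) A(3) ch(1) E(2) less.prems(1)] E t by simp
    then have ED: "\<delta> E D = t" using t E less.prems by simp
    have "len (s \<otimes> ?w) \<le> Suc (len (s \<otimes> v))"
      using len_mult_le[of "s \<otimes> v" t] t s by (simp add: m_assoc)
    then have "len v < len (s \<otimes> v)" using less.prems(2) t len_gen_cases[of s v] s by auto
    then have C'E: "\<delta> C' E = s \<otimes> v" using less.hyps[of E] E t by simp
    have "\<delta> D C' = \<delta> E C' \<or> \<delta> D C' = t \<otimes> \<delta> E C'"
      using \<delta>_step[OF E(2) less.prems(1) ch(2) ED t(1)] .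
    then have "\<delta> C' D = \<delta> C' E \<or> \<delta> C' D = \<delta> C' E \<otimes> t"
      using \<delta>_inv[OF ch(2) less.prems(1)] \<delta>_inv[OF ch(2) E(2)] ch E less.prems t
      by (metis \<delta>_closed gen_closed inv_closed inv_gen inv_inv inv_mult_group)
    then show ?thesis
    proof
      assume "\<delta> C' D = \<delta> C' E \<otimes> t"
      then show ?thesis using C'E t s by (simp add: m_assoc)
    next
      assume 1: "\<delta> C' D = \<delta> C' E"
      from \<delta>_step[OF ch less.prems(1) s] show ?thesis
      proof
        assume "\<delta> C' D = ?w"
        then have "s \<otimes> ?w = v" using 1 C'E t s by (metis gen_cancel)
        then show ?thesis using less.prems t by simp
      qed
    qed
  qed
qed

text \<open>
  Put the letters of a reduced word of \<open>\<delta>(C, X)\<close> in front of \<open>\<delta>(X, D)\<close> one at a time, the last one first.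
  Each of them increases the length, so \<open>\<delta>_step_up\<close> determines the new distance to \<open>D\<close>.
\<close>

lemma \<delta>_add:
  assumes "Ch C" "Ch X" "Ch D" "len (\<delta> C X \<otimes> \<delta> X D) = len (\<delta> C X) + len (\<delta> X D)"
  shows "\<delta> C D = \<delta> C X \<otimes> \<delta> X D"
  using assms
proof (induction "len (\<delta> C X)" arbitrary: C rule: less_induct)
  case less
  let ?u = "\<delta> C X" let ?v = "\<delta> X D"
  have c: "?u \<in> carrier W" "?v \<in> carrier W" using less.prems by auto
  show ?case
  proof (cases "?u = \<one>")
    case True
    then show ?thesis using \<delta>_eq_one_iff less.prems c by simp
  next
    case False
    then obtain s u where s: "s \<in> I" "u \<in> carrier W" "?u = s \<otimes> u" "len ?u = Suc (len u)"
      using first_letter[OF c(1)] by blast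
    obtain A where A: "A \<in> \<A>" "C \<in> A" "X \<in> A" using chambers_apartment less.prems by blast
    obtain E where E: "E \<in> A" "Ch E" "\<delta> C E = s"
      using apartment_chamber[OF A(1,2) less.prems(1)] s by blast
    have "s \<otimes> u = s \<otimes> \<delta> E X"
      using apartment_\<delta>_mult(1)[OF A(1,2) E(1) A(3) less.prems(1) E(2) less.prems(2)] E s by simp
    then have EX: "\<delta> E X = u" using s E less.prems by simp
    have "len (s \<otimes> (u \<otimes> ?v)) \<le> Suc (len (u \<otimes> ?v))" using len_mult_le[of s "u \<otimes> ?v"] s c by simp
    moreover have "len (s \<otimes> (u \<otimes> ?v)) = Suc (len u) + len ?v"
      using less.prems(4) s c by (simp add: m_assoc)
    moreover have "len (u \<otimes> ?v) \<le> len u + len ?v" using len_mult_le s c by simp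
    ultimately have len: "len (u \<otimes> ?v) = len u + len ?v" "len (u \<otimes> ?v) < len (s \<otimes> (u \<otimes> ?v))" by auto
    then have ED: "\<delta> E D = u \<otimes> ?v" using less.hyps[of E] EX E less.prems s by simp
    moreover have "\<delta> E C = s" using \<delta>_inv[OF less.prems(1) E(2)] E s by simp
    ultimately have "\<delta> C D = s \<otimes> (u \<otimes> ?v)"
      using \<delta>_step_up[OF E(2) less.prems(1) _ s(1) less.prems(3)] len by simp
    then show ?thesis using s c by (simp add: m_assoc)
  qed
qed

text \<open>
  Without a condition on lengths, each step of a gallery from \<open>C\<close> to \<open>X\<close> may or may not contribute its
  letter, so \<open>\<delta>(C, D)\<close> arises from \<open>\<delta>(C, X)\<close> by omitting letters. Both the bound on the support and the
  strict loss of length when a letter is omitted are used below.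
\<close>

lemma \<delta>_triangle:
  assumes "Ch C" "Ch X" "Ch D"
  shows "\<exists>p\<in>carrier W. \<delta> C D = p \<otimes> \<delta> X D \<and> (p = \<delta> C X \<or> len p < len (\<delta> C X)) \<and> supp p \<subseteq> supp (\<delta> C X)"
  using assms
proof (induction "len (\<delta> C X)" arbitrary: C rule: less_induct)
  case less
  let ?u = "\<delta> C X" let ?v = "\<delta> X D"
  have c: "?u \<in> carrier W" "?v \<in> carrier W" using less.prems by auto
  show ?case
  proof (cases "?u = \<one>")
    case True
    then show ?thesis using \<delta>_eq_one_iff less.prems c by (intro bexI[of _ \<one>]) auto
  next
    case False
    then obtain s u where s: "s \<in> I" "u \<in> carrier W" "?u = s \<otimes> u" "len ?u = Suc (len u)"
      using first_letter[OF c(1)] by blast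
    obtain A where A: "A \<in> \<A>" "C \<in> A" "X \<in> A" using chambers_apartment less.prems by blast
    obtain E where E: "E \<in> A" "Ch E" "\<delta> C E = s"
      using apartment_chamber[OF A(1,2) less.prems(1)] s by blast
    have "s \<otimes> u = s \<otimes> \<delta> E X"
      using apartment_\<delta>_mult(1)[OF A(1,2) E(1) A(3) less.prems(1) E(2) less.prems(2)] E s by simp
    then have EX: "\<delta> E X = u" using s E less.prems by simp
    obtain us where us: "us \<in> lists I" "wd us = u" "length us = len u" using reduced_word s by blast
    have red: "s # us \<in> lists I" "wd (s # us) = ?u" "length (s # us) = len ?u" using us s by auto
    have supp_u: "s \<in> supp ?u" unfolding supp_def using red by fastforce
    have "us \<in> lists (supp ?u)" unfolding supp_def using red by (fastforce simp: in_lists_conv_set)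
    then have "u \<in> generate W (supp ?u)" using word_in_generate[of "supp ?u" us] supp_subset us by blast
    then have supp_u': "supp u \<subseteq> supp ?u" using generate_iff_supp supp_subset by blast
    obtain p where p: "p \<in> carrier W" "\<delta> E D = p \<otimes> ?v" "p = u \<or> len p < len u" "supp p \<subseteq> supp u"
      using less.hyps[of E] less.prems E EX s by auto
    have "\<delta> E C = s" using \<delta>_inv[OF less.prems(1) E(2)] E s by simp
    from \<delta>_step[OF E(2) less.prems(1,3) this s(1)] show ?thesis
    proof
      assume "\<delta> C D = \<delta> E D"
      then show ?thesis using p s supp_u' by (intro bexI[of _ p]) auto
    next
      assume "\<delta> C D = s \<otimes> \<delta> E D"
      then have "\<delta> C D = (s \<otimes> p) \<otimes> ?v" using p s c by (simp add: m_assoc)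
      moreover have "supp (s \<otimes> p) \<subseteq> supp ?u" using supp_mult[of s p] s p supp_u supp_u' by auto
      moreover have "s \<otimes> p = ?u \<or> len (s \<otimes> p) < len ?u"
        using p(1,3) s len_mult_le[of s p] by auto
      ultimately show ?thesis using p s by (intro bexI[of _ "s \<otimes> p"]) auto
    qed
  qed
qed

section \<open>Galleries and convexity\<close>

lemma adjacent_iff:
  assumes "Ch C" "Ch D"
  shows "adjacent I \<tau> C D \<longleftrightarrow> \<delta> C D \<in> I"
proof -
  have "I - supp (\<delta> C D) = I - {i} \<longleftrightarrow> \<delta> C D = i" if "i \<in> I" for i
    using supp_singleton_iff[of "\<delta> C D" i] supp_subset[of "\<delta> C D"] that assms by auto
  then show ?thesis unfolding adjacent_def using \<delta>_Int[OF assms] by auto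
qed

lemma gallery_single: "gallery I \<Delta> \<tau> C D [X] \<longleftrightarrow> X = C \<and> X = D \<and> Ch C"
  by (auto simp: gallery_def)

lemma gallery_Cons:
  "gallery I \<Delta> \<tau> C D (X # Y # Cs) \<longleftrightarrow> X = C \<and> Ch C \<and> adjacent I \<tau> C Y \<and> gallery I \<Delta> \<tau> Y D (Y # Cs)"
  by (auto simp: gallery_def)

lemma gallery_length:
  assumes "gallery I \<Delta> \<tau> C D Cs"
  shows "Ch C \<and> Ch D \<and> len (\<delta> C D) < length Cs"
  using assms
proof (induction Cs arbitrary: C rule: induct_list012)
  case 1
  then show ?case by (simp add: gallery_def)
next
  case (2 X)
  then show ?case by (auto simp: gallery_single)
next
  case (3 X Y Cs)
  then have g: "Ch C" "adjacent I \<tau> C Y" "gallery I \<Delta> \<tau> Y D (Y # Cs)" by (auto simp: gallery_Cons)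
  then have IH: "Ch Y" "Ch D" "len (\<delta> Y D) < length (Y # Cs)" using 3 by auto
  let ?s = "\<delta> Y C"
  have s: "?s \<in> I" using adjacent_iff g IH \<delta>_inv[of C Y] by auto
  have "len (\<delta> C D) \<le> Suc (len (\<delta> Y D))"
    using \<delta>_step[OF IH(1) g(1) IH(2) refl s] len_mult_le[of ?s "\<delta> Y D"] s IH by auto
  then show ?case using IH g by simp
qed

lemma gallery_exists:
  assumes "Ch C" "Ch D"
  shows "\<exists>Cs. gallery I \<Delta> \<tau> C D Cs \<and> length Cs = Suc (len (\<delta> C D))"
  using assms
proof (induction "len (\<delta> C D)" arbitrary: C rule: less_induct)
  case less
  show ?case
  proof (cases "\<delta> C D = \<one>")
    case True
    then have "C = D" using \<delta>_eq_one_iff less.prems by blast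
    then show ?thesis using less.prems by (intro exI[of _ "[C]"]) (simp add: gallery_single)
  next
    case False
    then obtain s v where s: "s \<in> I" "v \<in> carrier W" "\<delta> C D = s \<otimes> v" "len (\<delta> C D) = Suc (len v)"
      using first_letter[of "\<delta> C D"] less.prems by blast
    obtain A where A: "A \<in> \<A>" "C \<in> A" "D \<in> A" using chambers_apartment less.prems by blast
    obtain E where E: "E \<in> A" "Ch E" "\<delta> C E = s"
      using apartment_chamber[OF A(1,2) less.prems(1)] s by blast
    have "s \<otimes> v = s \<otimes> \<delta> E D"
      using apartment_\<delta>_mult(1)[OF A(1,2) E(1) A(3) less.prems(1) E(2) less.prems(2)] E s by simp
    then have ED: "\<delta> E D = v" using s E less.prems by simp
    then obtain Cs where Cs: "gallery I \<Delta> \<tau> E D Cs" "length Cs = Suc (len v)"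
      using less.hyps[of E] s E less.prems by auto
    then obtain Cs' where "Cs = E # Cs'" by (cases Cs) (auto simp: gallery_def)
    then have "gallery I \<Delta> \<tau> C D (C # Cs)"
      using Cs(1) less.prems adjacent_iff[OF less.prems(1) E(2)] E s by (simp add: gallery_Cons)
    then show ?thesis using Cs s by (intro exI[of _ "C # Cs"]) simp
  qed
qed

lemma shortest_gallery_iff:
  "shortest_gallery I \<Delta> \<tau> C D Cs \<longleftrightarrow> gallery I \<Delta> \<tau> C D Cs \<and> length Cs = Suc (len (\<delta> C D))"
proof
  assume s: "shortest_gallery I \<Delta> \<tau> C D Cs"
  then have g: "gallery I \<Delta> \<tau> C D Cs" by (simp add: shortest_gallery_def)
  obtain Ds where Ds: "gallery I \<Delta> \<tau> C D Ds" "length Ds = Suc (len (\<delta> C D))"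
    using gallery_exists gallery_length[OF g] by blast
  then have "length Cs \<le> length Ds" using s unfolding shortest_gallery_def by blast
  then show "gallery I \<Delta> \<tau> C D Cs \<and> length Cs = Suc (len (\<delta> C D))"
    using g Ds gallery_length[OF g] by simp
next
  assume g: "gallery I \<Delta> \<tau> C D Cs \<and> length Cs = Suc (len (\<delta> C D))"
  show "shortest_gallery I \<Delta> \<tau> C D Cs"
    unfolding shortest_gallery_def using g gallery_length by (simp add: Suc_le_eq)
qed

text \<open>
  The chamber \<open>X\<close> lies on a shortest gallery from \<open>C\<close> to \<open>D\<close>; see \<open>shortest_gallery_between\<close> and
  \<open>between_shortest_gallery\<close>.
\<close>

definition between :: "'v set \<Rightarrow> 'v set \<Rightarrow> 'v set \<Rightarrow> bool" where
  "between C X D \<longleftrightarrow> Ch X \<and> len (\<delta> C X) + len (\<delta> X D) = len (\<delta> C D)"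

lemma \<delta>_len_triangle: "\<lbrakk>Ch C; Ch X; Ch D\<rbrakk> \<Longrightarrow> len (\<delta> C D) \<le> len (\<delta> C X) + len (\<delta> X D)"
proof -
  assume ch: "Ch C" "Ch X" "Ch D"
  then obtain p where "p \<in> carrier W" "\<delta> C D = p \<otimes> \<delta> X D" "p = \<delta> C X \<or> len p < len (\<delta> C X)"
    using \<delta>_triangle by blast
  then show ?thesis using len_mult_le[of p "\<delta> X D"] ch by auto
qed

lemma shortest_gallery_between:
  assumes "shortest_gallery I \<Delta> \<tau> C D Cs" "X \<in> set Cs"
  shows "between C X D"
proof -
  have g: "gallery I \<Delta> \<tau> C D Cs" "length Cs = Suc (len (\<delta> C D))"
    using assms shortest_gallery_iff by auto
  obtain as bs where Cs: "Cs = as @ X # bs" using assms(2) split_list by metis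
  have "gallery I \<Delta> \<tau> C X (as @ [X])" "gallery I \<Delta> \<tau> X D (X # bs)"
    using g(1) unfolding Cs gallery_def
    by (auto simp: successively_append_iff successively_Cons hd_append split: if_splits)
  then have "Ch X" "Ch C" "Ch D" "len (\<delta> C X) < length (as @ [X])" "len (\<delta> X D) < length (X # bs)"
    using gallery_length by blast+
  then show ?thesis using \<delta>_len_triangle[of C X D] g(2) Cs by (simp add: between_def)
qed

lemma between_shortest_gallery:
  assumes "Ch C" "Ch D" "between C X D"
  shows "\<exists>Cs. shortest_gallery I \<Delta> \<tau> C D Cs \<and> X \<in> set Cs"
proof -
  have X: "Ch X" "len (\<delta> C X) + len (\<delta> X D) = len (\<delta> C D)" using assms(3) by (auto simp: between_def)
  obtain Cs Ds where g: "gallery I \<Delta> \<tau> C X Cs" "length Cs = Suc (len (\<delta> C X))"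
    "gallery I \<Delta> \<tau> X D Ds" "length Ds = Suc (len (\<delta> X D))"
    using gallery_exists assms X by metis
  obtain Ds' where Ds: "Ds = X # Ds'" using g(3) by (cases Ds) (auto simp: gallery_def)
  obtain Cs' where Cs: "Cs = Cs' @ [X]" using g(1) by (cases Cs rule: rev_cases) (auto simp: gallery_def)
  have "gallery I \<Delta> \<tau> C D (Cs' @ Ds)"
    using g(1,3) unfolding gallery_def Cs Ds
    by (auto simp: successively_append_iff successively_Cons hd_append split: if_splits)
  moreover have "length (Cs' @ Ds) = Suc (len (\<delta> C D))" using g Cs Ds X by simp
  ultimately show ?thesis using shortest_gallery_iff Ds by (intro exI[of _ "Cs' @ Ds"]) simp
qed

lemma convex_iff_between:
  "convex_chamber_subcomplex I \<Delta> \<tau> \<Omega> \<longleftrightarrow> chamber_subcomplex I \<Delta> \<tau> \<Omega> \<and>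
    (\<forall>C\<in>\<Omega>. \<forall>D\<in>\<Omega>. \<forall>X. Ch C \<longrightarrow> Ch D \<longrightarrow> between C X D \<longrightarrow> X \<in> \<Omega>)"
  unfolding convex_chamber_subcomplex_def
  by (meson between_shortest_gallery shortest_gallery_between subset_iff)

lemma between_mult:
  assumes "Ch C" "Ch D" "between C X D"
  shows "\<delta> C D = \<delta> C X \<otimes> \<delta> X D"
proof -
  have X: "Ch X" "len (\<delta> C X) + len (\<delta> X D) = len (\<delta> C D)" using assms(3) by (auto simp: between_def)
  obtain p where p: "p \<in> carrier W" "\<delta> C D = p \<otimes> \<delta> X D" "p = \<delta> C X \<or> len p < len (\<delta> C X)"
    using \<delta>_triangle[OF assms(1) X(1) assms(2)] by blast
  then show ?thesis using len_mult_le[of p "\<delta> X D"] X assms by auto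
qed

lemma between_exists:
  assumes "Ch C" "Ch D" "u \<in> carrier W" "v \<in> carrier W" "\<delta> C D = u \<otimes> v" "len (u \<otimes> v) = len u + len v"
  shows "\<exists>X. between C X D \<and> Ch X \<and> \<delta> C X = u \<and> \<delta> X D = v"
proof -
  obtain A where A: "A \<in> \<A>" "C \<in> A" "D \<in> A" using chambers_apartment assms by blast
  obtain X where X: "X \<in> A" "Ch X" "\<delta> C X = u" using apartment_chamber[OF A(1,2) assms(1,3)] by blast
  have "u \<otimes> v = u \<otimes> \<delta> X D"
    using apartment_\<delta>_mult(1)[OF A(1,2) X(1) A(3) assms(1) X(2) assms(2)] X assms by simp
  then have "\<delta> X D = v" using assms X by simp
  then show ?thesis using X assms by (auto simp: between_def)
qed

text \<open>
  The first chambers \<open>E\<close>, \<open>F\<close> after \<open>C\<close> on the two galleries are \<open>s\<close>-adjacent to \<open>C\<close> and both closer to \<open>D\<close>.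
  A panel contains only one chamber that is closest to \<open>D\<close>, so \<open>E = F\<close>.
\<close>

lemma between_unique:
  assumes "Ch C" "Ch D" "between C X D" "between C Y D" "\<delta> C X = \<delta> C Y"
  shows "X = Y"
  using assms
proof (induction "len (\<delta> C X)" arbitrary: C rule: less_induct)
  case less
  note ch = less.prems(1,2)
  have X: "Ch X" "Ch Y" using less.prems by (auto simp: between_def)
  let ?p = "\<delta> C X" let ?q = "\<delta> X D"
  have pq: "\<delta> C D = ?p \<otimes> ?q" "len (\<delta> C D) = len ?p + len ?q"
    using between_mult[OF ch less.prems(3)] less.prems(3) by (simp_all add: between_def)
  have "?p \<otimes> \<delta> Y D = ?p \<otimes> ?q" using between_mult[OF ch less.prems(4)] pq less.prems(5) by simp
  then have Yq: "\<delta> Y D = ?q" using X ch by simp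
  show ?case
  proof (cases "?p = \<one>")
    case True
    then show ?thesis using \<delta>_eq_one_iff X ch less.prems(5) by metis
  next
    case False
    then obtain s u where s: "s \<in> I" "u \<in> carrier W" "?p = s \<otimes> u" "len ?p = Suc (len u)"
      using first_letter[of ?p] ch X by blast
    then have len: "len (s \<otimes> u) = len s + len u" by simp
    obtain E where E: "Ch E" "\<delta> C E = s" "\<delta> E X = u"
      using between_exists[OF ch(1) X(1) _ s(2,3) len] s(1) by auto
    obtain F where F: "Ch F" "\<delta> C F = s" "\<delta> F Y = u"
      using between_exists[OF ch(1) X(2) _ s(2) _ len] s(1,3) less.prems(5) by auto
    have "len (u \<otimes> ?q) = len u + len ?q" "len (s \<otimes> (u \<otimes> ?q)) = Suc (len u + len ?q)"
    proof -
      show *: "len (s \<otimes> (u \<otimes> ?q)) = Suc (len u + len ?q)"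
        using pq s X ch by (simp add: m_assoc)
      show "len (u \<otimes> ?q) = len u + len ?q"
        using * len_mult_le[of u ?q] len_mult_le[of s "u \<otimes> ?q"] s X ch by simp
    qed
    note uq = this
    have ED: "\<delta> E D = u \<otimes> ?q" using \<delta>_add[OF E(1) X(1) ch(2)] E uq by simp
    have FD: "\<delta> F D = u \<otimes> ?q" using \<delta>_add[OF F(1) X(2) ch(2)] F uq Yq by simp
    have "E = F"
    proof (rule ccontr)
      assume "E \<noteq> F"
      moreover have "\<delta> E F = s \<or> \<delta> E F = \<one>" using \<delta>_step[OF ch(1) E(1) F(1) E(2) s(1)] F s by simp
      ultimately have "\<delta> E F = s" using \<delta>_eq_one_iff E F by blast
      then have "\<delta> F D = s \<otimes> (u \<otimes> ?q)"
        using \<delta>_step_up[OF E(1) F(1) _ s(1) ch(2)] ED uq by simp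
      then show False using FD uq by simp
    qed
    have "between E X D" "between E Y D"
      using E F ED uq X Yq \<open>E = F\<close> by (auto simp: between_def)
    then show ?thesis using less.hyps[of E] E F \<open>E = F\<close> s ch by simp
  qed
qed

section \<open>Apartments, half-apartments and opposite chambers\<close>

lemma apartment_between:
  assumes A: "A \<in> \<A>" "C \<in> A" "D \<in> A" and ch: "Ch C" "Ch D" and X: "between C X D"
  shows "X \<in> A"
proof -
  have X': "Ch X" using X by (simp add: between_def)
  obtain Y where Y: "Y \<in> A" "Ch Y" "\<delta> C Y = \<delta> C X"
    using apartment_chamber[OF A(1,2) ch(1), of "\<delta> C X"] ch X' by auto
  have "\<delta> C X \<otimes> \<delta> X D = \<delta> C X \<otimes> \<delta> Y D"
    using between_mult[OF ch X] apartment_\<delta>_mult(1)[OF A(1,2) Y(1) A(3) ch(1) Y(2) ch(2)] Y by simp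
  then have "\<delta> X D = \<delta> Y D" using ch X' Y by simp
  then have "between C Y D" using X Y by (simp add: between_def)
  then show ?thesis using between_unique[OF ch X _ Y(3)[symmetric]] Y by simp
qed

lemma apartment_chamber_subcomplex: "A \<in> \<A> \<Longrightarrow> chamber_subcomplex I \<Delta> \<tau> A"
  unfolding chamber_subcomplex_def subcomplex_def
  using apartment_subset apartment_face apartment_face_of_chamber by blast

lemma apartment_convex: "A \<in> \<A> \<Longrightarrow> convex_chamber_subcomplex I \<Delta> \<tau> A"
  unfolding convex_iff_between using apartment_chamber_subcomplex apartment_between by blast

lemma between_w0:
  assumes A: "A \<in> \<A>" "C \<in> A" "D \<in> A" "X \<in> A" and ch: "Ch C" "Ch D" "Ch X" and "\<delta> C D = w0"
  shows "between C X D"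
proof -
  have "w0 = \<delta> C X \<otimes> \<delta> X D" using apartment_\<delta>_mult(1)[OF A(1,2,4,3)] ch assms(8) by simp
  then have "\<delta> X D = inv (\<delta> C X) \<otimes> w0" using ch by simp
  then show ?thesis using len_mult_w0[of "inv (\<delta> C X)"] ch assms(8) by (simp add: between_def)
qed

text \<open>
  The chambers of \<open>A\<close> on the same side of the wall of \<open>t\<close> as \<open>C\<close>, with all their faces; \<open>A\<close> is identified
  with the Coxeter complex so that \<open>C\<close> is the fundamental chamber.
\<close>

definition half_apartment :: "'v set set \<Rightarrow> 'v set \<Rightarrow> 'a \<Rightarrow> 'v set set" where
  "half_apartment A C t = {R. \<exists>X\<in>A. Ch X \<and> R \<subseteq> X \<and> \<not> sep (\<delta> C X) t}"

lemma half_apartment_chamber: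
  assumes "X \<in> half_apartment A C t" "Ch X"
  shows "X \<in> A" "\<not> sep (\<delta> C X) t"
proof -
  obtain Y where "Y \<in> A" "Ch Y" "X \<subseteq> Y" "\<not> sep (\<delta> C Y) t" using assms by (auto simp: half_apartment_def)
  moreover then have "X = Y" using chamber_subset_eq assms by blast
  ultimately show "X \<in> A" "\<not> sep (\<delta> C X) t" by auto
qed

text \<open>
  A gallery between two chambers on one side of a wall that meets the other side can be shortened by
  reflecting the part on the other side. In terms of Weyl distances, both \<open>\<delta>(X, Z)\<close> and \<open>\<delta>(Z, Y)\<close> can
  be multiplied by conjugates of \<open>t\<close> that shorten them and cancel in the product.
\<close>

lemma half_apartment_convex:
  assumes A: "A \<in> \<A>" "C \<in> A" and C: "Ch C" and t: "t \<in> carrier W" "t \<otimes> t = \<one>"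
  shows "convex_chamber_subcomplex I \<Delta> \<tau> (half_apartment A C t)"
  unfolding convex_iff_between
proof (intro conjI ballI allI impI)
  show "chamber_subcomplex I \<Delta> \<tau> (half_apartment A C t)"
    unfolding chamber_subcomplex_def subcomplex_def
  proof (intro conjI ballI allI impI subsetI)
    fix R assume "R \<in> half_apartment A C t"
    then show "R \<in> \<Delta>" using apartment_subset[OF A(1)] complex_face by (auto simp: half_apartment_def)
  next
    fix R S assume "R \<in> half_apartment A C t" "S \<subseteq> R"
    then show "S \<in> half_apartment A C t" by (auto simp: half_apartment_def)
  next
    fix R assume "R \<in> half_apartment A C t"
    then show "\<exists>X\<in>half_apartment A C t. Ch X \<and> R \<subseteq> X" by (auto simp: half_apartment_def)
  qed
next
  fix X Y Z
  assume XY: "X \<in> half_apartment A C t" "Y \<in> half_apartment A C t" and ch: "Ch X" "Ch Y"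
    and Z: "between X Z Y"
  have X: "X \<in> A" "\<not> sep (\<delta> C X) t" and Y: "Y \<in> A" "\<not> sep (\<delta> C Y) t"
    using half_apartment_chamber[OF XY(1) ch(1)] half_apartment_chamber[OF XY(2) ch(2)] by blast+
  have ZA: "Z \<in> A" using apartment_between[OF A(1) X(1) Y(1) ch Z] .
  have Zc: "Ch Z" using Z by (simp add: between_def)
  let ?a = "\<delta> C X" let ?c = "\<delta> C Z" let ?p = "\<delta> X Z" let ?q = "\<delta> Z Y"
  have cl: "?a \<in> carrier W" "?c \<in> carrier W" "?p \<in> carrier W" "?q \<in> carrier W" using C ch Zc by auto
  have c: "?c = ?a \<otimes> ?p" using apartment_\<delta>_mult(1)[OF A X(1) ZA C ch(1) Zc] .
  have b: "\<delta> C Y = ?c \<otimes> ?q" using apartment_\<delta>_mult(1)[OF A ZA Y(1) C Zc ch(2)] .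
  have "\<not> sep ?c t"
  proof
    assume sep: "sep ?c t"
    let ?ta = "inv ?a \<otimes> t \<otimes> ?a" let ?tc = "inv ?c \<otimes> t \<otimes> ?c"
    have "sep (?a \<otimes> ?p) t" using sep c by simp
    then have "sep ?p ?ta" using X sep_mult[of ?a ?p t] cl t by simp
    then have 1: "len (?ta \<otimes> ?p) < len ?p" using len_sep cl t by simp
    have "\<not> sep (?c \<otimes> ?q) t" using Y b by simp
    then have "sep ?q ?tc" using sep sep_mult[of ?c ?q t] cl t by simp
    then have 2: "len (?tc \<otimes> ?q) < len ?q" using len_sep cl t by simp
    have "?ta \<otimes> ?p = inv ?a \<otimes> (t \<otimes> ?c)" using c cl t by (simp add: m_assoc)
    then have "(?ta \<otimes> ?p) \<otimes> (?tc \<otimes> ?q) = inv ?a \<otimes> ((t \<otimes> t) \<otimes> (?c \<otimes> ?q))"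
      using cl t(1) by (simp add: m_assoc)
    also have "\<dots> = ?p \<otimes> ?q" using t c cl by (simp add: m_assoc)
    finally have "len (?p \<otimes> ?q) \<le> len (?ta \<otimes> ?p) + len (?tc \<otimes> ?q)"
      using len_mult_le[of "?ta \<otimes> ?p" "?tc \<otimes> ?q"] cl t by simp
    then show False using 1 2 between_mult[OF ch Z] Z by (simp add: between_def)
  qed
  then show "Z \<in> half_apartment A C t" using ZA Zc by (auto simp: half_apartment_def)
qed

text \<open>
  If \<open>\<delta>(C, D) = w\<^sub>0\<close>, then every chamber of an apartment containing \<open>C\<close> and \<open>D\<close> lies on a shortest gallery
  between them, so the apartment is their hull. If \<open>\<delta>(C, D) \<noteq> w\<^sub>0\<close>, then in any apartment containing
  \<open>C\<close> and \<open>D\<close> some chamber adjacent to \<open>D\<close> is further away from \<open>C\<close>, and the wall between it and \<open>D\<close>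
  bounds a half-apartment that contains the hull; so no apartment is the hull.
\<close>

lemma opposite_chambers_iff:
  assumes ch: "Ch C" "Ch D"
  shows "opposite_chambers I \<Delta> \<tau> \<A> C D \<longleftrightarrow> \<delta> C D = w0"
proof
  assume w0: "\<delta> C D = w0"
  obtain A where A: "A \<in> \<A>" "C \<in> A" "D \<in> A" using chambers_apartment ch by blast
  have "convex_chamber_subcomplex I \<Delta> \<tau> hull {C, D} = A"
  proof (rule hull_unique)
    show "{C, D} \<subseteq> A" using A by simp
    show "convex_chamber_subcomplex I \<Delta> \<tau> A" using apartment_convex A by blast
    fix B assume B: "{C, D} \<subseteq> B" "convex_chamber_subcomplex I \<Delta> \<tau> B"
    show "A \<subseteq> B"
    proof
      fix R assume "R \<in> A"
      then obtain X where X: "X \<in> A" "Ch X" "R \<subseteq> X" using apartment_face_of_chamber A by blast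
      have "C \<in> B" "D \<in> B" using B(1) by auto
      then have "X \<in> B"
        using B(2) ch between_w0[OF A X(1) ch X(2) w0] unfolding convex_iff_between by metis
      then show "R \<in> B"
        using B(2) X(3) by (simp add: convex_chamber_subcomplex_def chamber_subcomplex_def subcomplex_def)
    qed
  qed
  then show "opposite_chambers I \<Delta> \<tau> \<A> C D" using A ch by (simp add: opposite_chambers_def)
next
  assume "opposite_chambers I \<Delta> \<tau> \<A> C D"
  then obtain A where A: "A \<in> \<A>" and hull: "convex_chamber_subcomplex I \<Delta> \<tau> hull {C, D} = A"
    by (auto simp: opposite_chambers_def)
  have CD: "C \<in> A" "D \<in> A" using hull hull_inc[of _ "{C, D}"] by blast+
  let ?w = "\<delta> C D"
  have w: "?w \<in> carrier W" using ch by simp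
  show "?w = w0"
  proof (rule ccontr)
    assume "?w \<noteq> w0"
    then obtain s where s: "s \<in> I" "\<not> len (?w \<otimes> s) < len ?w" using all_descents_w0[OF w] by blast
    obtain E where E: "E \<in> A" "Ch E" "\<delta> C E = ?w \<otimes> s"
      using apartment_chamber[OF A CD(1) ch(1), of "?w \<otimes> s"] w s by auto
    let ?t = "?w \<otimes> s \<otimes> inv ?w"
    have t: "?t \<in> carrier W" "?t \<otimes> ?t = \<one>" "?t \<otimes> ?w = ?w \<otimes> s" "inv ?w \<otimes> ?t \<otimes> ?w = s"
      using w s by (simp_all add: m_assoc)
    have D: "\<not> sep ?w ?t" using len_sep[OF w t(1)] t(3) s(2) by auto
    have "C \<in> half_apartment A C ?t" using CD ch t by (auto simp: half_apartment_def)
    moreover have "D \<in> half_apartment A C ?t" using CD ch D by (auto simp: half_apartment_def)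
    ultimately have "A \<subseteq> half_apartment A C ?t"
      using hull_minimal[of "{C, D}" "half_apartment A C ?t" "convex_chamber_subcomplex I \<Delta> \<tau>"]
        half_apartment_convex[OF A CD(1) ch(1) t(1,2)] hull by blast
    then have "\<not> sep (?w \<otimes> s) ?t" using half_apartment_chamber(2)[of E A C ?t] E by auto
    moreover have "sep (?w \<otimes> s) ?t" using sep_mult[OF w _ t(1), of s] D t(4) sep_gen s by simp
    ultimately show False by blast
  qed
qed

section \<open>Opposite simplices\<close>

text \<open>
  A chamber of the apartment at maximal distance from \<open>C\<close> is opposite to \<open>C\<close>, since none of its neighbours
  in the apartment is further away.
\<close>

lemma opposite_in_apartment:
  assumes A: "A \<in> \<A>" "X \<in> A" "Ch X" and C: "Ch C"
  shows "\<exists>D\<in>A. Ch D \<and> \<delta> C D = w0"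
proof -
  have bound: "len (\<delta> C D) < Suc (len w0)" if "Ch D" for D
    using len_mult_w0[of "\<delta> C D"] C that by simp
  then have "\<forall>E. E \<in> A \<and> Ch E \<longrightarrow> len (\<delta> C E) < Suc (len w0)" by simp
  then obtain D where D: "D \<in> A" "Ch D" and max: "\<And>E. E \<in> A \<Longrightarrow> Ch E \<Longrightarrow> len (\<delta> C E) \<le> len (\<delta> C D)"
    using ex_has_greatest_nat[of "\<lambda>D. D \<in> A \<and> Ch D" X "\<lambda>D. len (\<delta> C D)" "Suc (len w0)"] A by blast
  let ?u = "\<delta> C D"
  have u: "?u \<in> carrier W" "\<delta> D C = inv ?u"
    using \<delta>_closed[OF C D(2)] \<delta>_inv[OF C D(2)] by simp_all
  have "len (?u \<otimes> s) < len ?u" if s: "s \<in> I" for s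
  proof (rule ccontr)
    assume "\<not> len (?u \<otimes> s) < len ?u"
    moreover have us: "?u \<otimes> s = inv (s \<otimes> inv ?u)" using u s by (simp add: inv_mult_group)
    then have len: "len (?u \<otimes> s) = len (s \<otimes> inv ?u)" using u s by simp
    ultimately have up: "len (\<delta> D C) < len (s \<otimes> \<delta> D C)"
      using len_gen_cases[of s "inv ?u"] u s by auto
    obtain E where E: "E \<in> A" "Ch E" "\<delta> D E = s" using apartment_chamber[OF A(1) D] s by blast
    have "\<delta> E C = s \<otimes> inv ?u" using \<delta>_step_up[OF D(2) E(2,3) s C up] u by simp
    then have "\<delta> C E = ?u \<otimes> s" using \<delta>_inv[OF E(2) C] us by simp
    then have "len ?u < len (\<delta> C E)" using up len u by simp
    then show False using max[OF E(1,2)] by simp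
  qed
  then have "?u = w0" using all_descents_w0 u by blast
  then show ?thesis using D by blast
qed

lemma opposite_pair_imp_all_chambers:
  assumes \<Omega>: "convex_chamber_subcomplex I \<Delta> \<tau> \<Omega>"
    and X: "X \<in> \<Omega>" "Y \<in> \<Omega>" "Ch X" "Ch Y" "\<delta> X Y = w0" and C: "Ch C"
  shows "\<exists>D\<in>\<Omega>. Ch D \<and> \<delta> C D = w0"
proof -
  obtain A where A: "A \<in> \<A>" "X \<in> A" "Y \<in> A" using chambers_apartment X by blast
  obtain D where D: "D \<in> A" "Ch D" "\<delta> C D = w0" using opposite_in_apartment[OF A(1,2) X(3) C] by blast
  have "between X D Y" using between_w0[OF A D(1) X(3,4) D(2) X(5)] .
  then have "D \<in> \<Omega>" using \<Omega> X unfolding convex_iff_between by metis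
  then show ?thesis using D by blast
qed

text \<open>
  If \<open>C'\<close> shares the face of type \<open>J\<close> with \<open>C\<close>, then \<open>\<delta>(C', D) = q w\<^sub>0\<close> with \<open>q\<close> in the parabolic subgroup
  of \<open>I - J\<close>. As \<open>q w\<^sub>0 = w\<^sub>0 u\<close> with \<open>u = w\<^sub>0 q w\<^sub>0\<close>, undoing \<open>u\<close> moves \<open>D\<close> to an opposite of \<open>C'\<close> without
  changing the face of the opposite type.
\<close>

lemma opposite_face_of_chamber:
  assumes ch: "Ch C" "Ch D" "\<delta> C D = w0" and J: "J \<subseteq> I" and C': "Ch C'" "J \<subseteq> \<tau> ` (C \<inter> C')"
  shows "\<exists>D'. Ch D' \<and> (\<lambda>s. w0 \<otimes> s \<otimes> w0) ` J \<subseteq> \<tau> ` (D \<inter> D') \<and> \<delta> C' D' = w0"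
proof -
  let ?f = "\<lambda>s. w0 \<otimes> s \<otimes> w0"
  have "supp (\<delta> C' C) \<subseteq> I - J"
    using C' \<delta>_Int[OF C'(1) ch(1)] supp_subset[of "\<delta> C' C"] by (auto simp: Int_commute)
  then obtain q where q: "q \<in> carrier W" "\<delta> C' D = q \<otimes> w0" "supp q \<subseteq> I - J"
    using \<delta>_triangle[OF C'(1) ch(1,2)] ch(3) by force
  let ?u = "w0 \<otimes> q \<otimes> w0"
  have "q \<in> generate W (I - J)" using q generate_iff_supp[of "I - J"] by simp
  then have u: "?u \<in> generate W (?f ` (I - J))" using w0_conj_generate[of "I - J" q] by simp
  have fI: "?f ` (I - J) \<subseteq> I" "?f ` J \<subseteq> I" using w0_conj_gen J by auto
  have uc: "?u \<in> carrier W" using q by simp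
  obtain A where A: "A \<in> \<A>" "C' \<in> A" "D \<in> A" using chambers_apartment C' ch by blast
  obtain D' where D': "D' \<in> A" "Ch D'" "\<delta> D D' = inv ?u"
    using apartment_chamber[OF A(1,3) ch(2), of "inv ?u"] uc by auto
  have "\<delta> C' D' = (q \<otimes> w0) \<otimes> inv ?u"
    using apartment_\<delta>_mult(1)[OF A(1,2,3) D'(1) C'(1) ch(2) D'(2)] q D' by simp
  also have "\<dots> = w0" using q(1) by (simp add: m_assoc inv_mult_group)
  finally have opp: "\<delta> C' D' = w0" .
  have "inv ?u \<in> generate W (?f ` (I - J))" using generate_inv[OF fI(1) u] .
  then have "supp (inv ?u) \<subseteq> ?f ` (I - J)" using generate_iff_supp[OF fI(1)] by blast
  moreover have "?f ` (I - J) \<inter> ?f ` J = {}"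
  proof -
    have "s = t" if "s \<in> I" "t \<in> I" "?f s = ?f t" for s t
      using that by simp
    then show ?thesis using J by blast
  qed
  ultimately have "?f ` J \<subseteq> I - supp (\<delta> D D')" using fI D'(3) by auto
  then show ?thesis using \<delta>_Int[OF ch(2) D'(2)] D' opp by auto
qed

lemma w0_conj_image: "J \<subseteq> I \<Longrightarrow> (\<lambda>s. w0 \<otimes> s \<otimes> w0) ` (\<lambda>s. w0 \<otimes> s \<otimes> w0) ` J = J"
proof -
  assume J: "J \<subseteq> I"
  have "w0 \<otimes> (w0 \<otimes> s \<otimes> w0) \<otimes> w0 = s" if "s \<in> J" for s
  proof -
    have "s \<in> carrier W" using that J by auto
    then show ?thesis by (simp add: m_assoc)
  qed
  then show ?thesis by (simp add: image_image cong: image_cong_simp)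
qed

lemma opposite_face:
  assumes ch: "Ch C" "Ch D" "\<delta> C D = w0" and R: "R \<subseteq> C"
  shows "\<exists>S\<subseteq>D. opposite I \<Delta> \<tau> \<A> R S"
proof -
  let ?f = "\<lambda>s. w0 \<otimes> s \<otimes> w0"
  define J where "J = \<tau> ` R"
  have J: "J \<subseteq> I" using R ch(1) by (auto simp: J_def chamber_def)
  have fJ: "?f ` J \<subseteq> I" using w0_conj_gen J by auto
  define S where "S = {v \<in> D. \<tau> v \<in> ?f ` J}"
  have S: "S \<subseteq> D" "\<tau> ` S = ?f ` J"
  proof -
    have "\<tau> ` {v \<in> D. \<tau> v \<in> B} = B \<inter> \<tau> ` D" for B by blast
    then show "\<tau> ` S = ?f ` J" using fJ ch(2) unfolding S_def by (simp add: chamber_def Int_absorb2)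
  qed (simp add: S_def)
  have DC: "\<delta> D C = w0" using \<delta>_inv[OF ch(1,2)] ch(3) by simp
  have 1: "\<exists>C'\<in>St \<Delta> S. opposite_chambers I \<Delta> \<tau> \<A> X C'" if X: "X \<in> St \<Delta> R" "Ch X" for X
  proof -
    have "R \<subseteq> C \<inter> X" using R X by (auto simp: St_def)
    then have "J \<subseteq> \<tau> ` (C \<inter> X)" unfolding J_def by (rule image_mono)
    then obtain Y where Y: "Ch Y" "?f ` J \<subseteq> \<tau> ` (D \<inter> Y)" "\<delta> X Y = w0"
      using opposite_face_of_chamber[OF ch J X(2)] by blast
    then have "S \<subseteq> D \<inter> Y" using face_eq[of D S "D \<inter> Y"] S ch(2) chamber_simplex by auto
    then have "Y \<in> St \<Delta> S" using Y by (auto simp: St_def chamber_def)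
    then show ?thesis using opposite_chambers_iff X Y by blast
  qed
  have 2: "\<exists>C'\<in>St \<Delta> R. opposite_chambers I \<Delta> \<tau> \<A> Y C'" if Y: "Y \<in> St \<Delta> S" "Ch Y" for Y
  proof -
    have "S \<subseteq> D \<inter> Y" using S Y by (auto simp: St_def)
    then have "?f ` J \<subseteq> \<tau> ` (D \<inter> Y)" using S(2) image_mono by metis
    then obtain X where X: "Ch X" "?f ` ?f ` J \<subseteq> \<tau> ` (C \<inter> X)" "\<delta> Y X = w0"
      using opposite_face_of_chamber[OF ch(2,1) DC fJ Y(2)] by blast
    then have "J \<subseteq> \<tau> ` (C \<inter> X)" using w0_conj_image[OF J] by simp
    then have "R \<subseteq> C \<inter> X" using face_eq[of C R "C \<inter> X"] R ch(1) chamber_simplex by (auto simp: J_def)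
    then have "X \<in> St \<Delta> R" using X by (auto simp: St_def chamber_def)
    then show ?thesis using opposite_chambers_iff X Y by blast
  qed
  have "R \<in> \<Delta>" "S \<in> \<Delta>" using R S ch chamber_simplex complex_face by blast+
  then have "opposite I \<Delta> \<tau> \<A> R S" unfolding opposite_def using 1 2 by blast
  then show ?thesis using S by blast
qed

section \<open>Convex subcomplexes with opposites of one type\<close>

lemma opposite_vertex_chamber:
  assumes C: "Ch C" "v \<in> C" "\<tau> v = k" and E: "Ch E" "B \<subseteq> E" and opp: "opposite I \<Delta> \<tau> \<A> {v} B"
  shows "\<exists>z\<in>generate W (I - {k}). \<delta> C E = z \<otimes> w0"
proof -
  have "E \<in> St \<Delta> B" using E by (simp add: St_def chamber_def)
  then obtain D where D: "D \<in> St \<Delta> {v}" "opposite_chambers I \<Delta> \<tau> \<A> E D"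
    using opp E(1) unfolding opposite_def by blast
  then have Dc: "Ch D" by (simp add: opposite_chambers_def)
  then have "\<delta> E D = w0" using opposite_chambers_iff E D by blast
  then have DE: "\<delta> D E = w0" using \<delta>_inv[OF E(1) Dc] by simp
  obtain p where p: "p \<in> carrier W" "\<delta> C E = p \<otimes> w0" "supp p \<subseteq> supp (\<delta> C D)"
    using \<delta>_triangle[OF C(1) Dc E(1)] DE by auto
  have "k \<in> \<tau> ` (C \<inter> D)" using C D by (auto simp: St_def)
  then have "supp p \<subseteq> I - {k}" using \<delta>_Int[OF C(1) Dc] p(3) supp_subset[of p] by blast
  then show ?thesis using p generate_iff_supp[of "I - {k}" p] by blast
qed

text \<open>
  This is the minimality argument described at the beginning, with the chambers named as there.
\<close>

lemma exists_opposite_chambers: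
  assumes irr: "irreducible_coxeter W I" and k: "k \<in> I"
    and \<Omega>: "convex_chamber_subcomplex I \<Delta> \<tau> \<Omega>" "C0 \<in> \<Omega>" "Ch C0"
    and opp: "\<And>C. C \<in> \<Omega> \<Longrightarrow> Ch C \<Longrightarrow> \<exists>E\<in>\<Omega>. Ch E \<and> (\<exists>z\<in>generate W (I - {k}). \<delta> C E = z \<otimes> w0)"
  shows "\<exists>C\<in>\<Omega>. \<exists>D\<in>\<Omega>. Ch C \<and> Ch D \<and> \<delta> C D = w0"
proof -
  let ?J = "I - {k}"
  let ?P = "\<lambda>(C, D, y). C \<in> \<Omega> \<and> D \<in> \<Omega> \<and> Ch C \<and> Ch D \<and> y \<in> generate W ?J \<and> \<delta> C D = y \<otimes> w0"
  have JI: "?J \<subseteq> I" by blast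
  have conv: "X \<in> \<Omega>" if "C \<in> \<Omega>" "D \<in> \<Omega>" "Ch C" "Ch D" "between C X D" for C D X
    using that \<Omega>(1) unfolding convex_iff_between by metis
  obtain E z where "E \<in> \<Omega>" "Ch E" "z \<in> generate W ?J" "\<delta> C0 E = z \<otimes> w0" using opp \<Omega> by blast
  then have "?P (C0, E, z)" using \<Omega> by simp
  then obtain T where T: "?P T" "\<And>T'. ?P T' \<Longrightarrow> len (snd (snd T)) \<le> len (snd (snd T'))"
    using ex_has_least_nat[of ?P "(C0, E, z)" "\<lambda>T. len (snd (snd T))"] by blast
  obtain C D y where [simp]: "T = (C, D, y)" by (cases T)
  have CD: "C \<in> \<Omega>" "D \<in> \<Omega>" "Ch C" "Ch D" "y \<in> generate W ?J" "\<delta> C D = y \<otimes> w0" using T(1) by auto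
  have min: "len y \<le> len y'" if "C' \<in> \<Omega>" "D' \<in> \<Omega>" "Ch C'" "Ch D'" "y' \<in> generate W ?J" "\<delta> C' D' = y' \<otimes> w0"
    for C' D' y' using T(2)[of "(C', D', y')"] that by simp
  have yc: "y \<in> carrier W" using generate_closed[OF JI CD(5)] .
  have "y = \<one>"
  proof (rule ccontr)
    assume "y \<noteq> \<one>"
    then obtain x n r where xnr: "x \<in> carrier W" "n \<in> generate W ?J" "r \<in> carrier W"
        "len (x \<otimes> y) = len x + len y" "x \<otimes> y = n \<otimes> r" "len n < len y"
        "\<And>s. s \<in> ?J \<Longrightarrow> len (s \<otimes> r) = Suc (len r)"
      using parabolic_shortening[OF irr k CD(5)] by blast
    have nc: "n \<in> carrier W" using generate_closed[OF JI xnr(2)] .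
    let ?wJ = "longest ?J"
    have wJ: "?wJ \<in> carrier W" "?wJ \<in> generate W ?J" using longest(1)[OF JI] longest_closed[OF JI] by auto
    note lw0 = len_mult_w0
    have "\<delta> C D = inv x \<otimes> (x \<otimes> y \<otimes> w0)" using CD(6) xnr(1) yc by (simp add: m_assoc)
    moreover have "len (inv x \<otimes> (x \<otimes> y \<otimes> w0)) = len (inv x) + len (x \<otimes> y \<otimes> w0)"
    proof -
      have "inv x \<otimes> (x \<otimes> y \<otimes> w0) = y \<otimes> w0" using xnr(1) yc by (simp add: m_assoc)
      then show ?thesis using lw0[of y] lw0[of "x \<otimes> y"] xnr(1,4) yc by simp
    qed
    ultimately obtain X where X: "between C X D" "Ch X" "\<delta> X D = x \<otimes> y \<otimes> w0"
      using between_exists[OF CD(3,4), of "inv x" "x \<otimes> y \<otimes> w0"] xnr(1) yc by auto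
    have X\<Omega>: "X \<in> \<Omega>" using conv[OF CD(1-4) X(1)] .
    \<comment> \<open>Multiplication by \<open>w0\<close> turns the absence of left descents of \<open>r\<close> in \<open>J\<close> into their presence, so the
      factor \<open>longest J\<close> can be split off from \<open>r w0\<close>.\<close>
    have desc: "len (s \<otimes> (r \<otimes> w0)) < len (r \<otimes> w0)" if s: "s \<in> ?J" for s
    proof -
      have "s \<otimes> (r \<otimes> w0) = (s \<otimes> r) \<otimes> w0" using s xnr(3) by (simp add: m_assoc)
      then show ?thesis using lw0[of r] lw0[of "s \<otimes> r"] xnr(3) xnr(7)[OF s] s by simp
    qed
    have rc: "r \<otimes> w0 \<in> carrier W" using xnr(3) by simp
    have cm: "len (m \<otimes> (r \<otimes> w0)) + len m = len (r \<otimes> w0)" if "m \<in> generate W ?J" for m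
      by (rule coset_maximal[OF JI rc _ that]) (rule desc)
    have XD: "\<delta> X D = (n \<otimes> ?wJ) \<otimes> (?wJ \<otimes> (r \<otimes> w0))"
      using X(3) xnr(3,5) nc wJ longest_sq[OF JI] by (simp add: m_assoc flip: m_assoc[of ?wJ ?wJ])
    have nw: "len (n \<otimes> ?wJ) + len n = len ?wJ" using len_mult_longest[OF JI xnr(2)] .
    have "len ((n \<otimes> ?wJ) \<otimes> (?wJ \<otimes> (r \<otimes> w0))) = len (n \<otimes> ?wJ) + len (?wJ \<otimes> (r \<otimes> w0))"
    proof -
      have "(n \<otimes> ?wJ) \<otimes> (?wJ \<otimes> (r \<otimes> w0)) = n \<otimes> (r \<otimes> w0)"
        using nc rc wJ longest_sq[OF JI] by (simp add: m_assoc flip: m_assoc[of ?wJ ?wJ])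
      then show ?thesis using cm[OF xnr(2)] cm[OF wJ(2)] nw by simp
    qed
    then obtain Y where Y: "between X Y D" "Ch Y" "\<delta> X Y = n \<otimes> ?wJ"
      using between_exists[OF X(2) CD(4) _ _ XD] nc wJ rc by auto
    have Y\<Omega>: "Y \<in> \<Omega>" using conv[OF X\<Omega> CD(2) X(2) CD(4) Y(1)] .
    obtain E z where E: "E \<in> \<Omega>" "Ch E" "z \<in> generate W ?J" "\<delta> Y E = z \<otimes> w0" using opp[OF Y\<Omega> Y(2)] by blast
    have zc: "z \<in> carrier W" using generate_closed[OF JI E(3)] .
    \<comment> \<open>The second factor in \<open>z w0 = (longest J \<cdot> w0) g\<close>; its length is that of \<open>longest J \<cdot> z\<close>.\<close>
    let ?g = "w0 \<otimes> (?wJ \<otimes> (z \<otimes> w0))"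
    have gc: "?g \<in> carrier W" using wJ zc by simp
    have g: "(?wJ \<otimes> w0) \<otimes> ?g = z \<otimes> w0"
      using wJ zc longest_sq[OF JI] by (simp add: m_assoc flip: m_assoc[of ?wJ ?wJ])
    have "len ?g = len (?wJ \<otimes> z)"
      using len_w0_mult[of "?wJ \<otimes> z \<otimes> w0"] lw0[of "?wJ \<otimes> z"] wJ zc by (simp add: m_assoc)
    then have "len ((?wJ \<otimes> w0) \<otimes> ?g) = len (?wJ \<otimes> w0) + len ?g"
      unfolding g using len_longest_mult[OF JI E(3)] lw0[of z] lw0[of ?wJ] zc wJ by simp
    then obtain F where F: "between Y F E" "Ch F" "\<delta> Y F = ?wJ \<otimes> w0"
      using between_exists[OF Y(2) E(2) _ gc, of "?wJ \<otimes> w0"] g E(4) wJ by auto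
    have F\<Omega>: "F \<in> \<Omega>" using conv[OF Y\<Omega> E(1) Y(2) E(2) F(1)] .
    have XF: "(n \<otimes> ?wJ) \<otimes> (?wJ \<otimes> w0) = n \<otimes> w0"
      using nc wJ longest_sq[OF JI] by (simp add: m_assoc flip: m_assoc[of ?wJ ?wJ])
    have "len ((n \<otimes> ?wJ) \<otimes> (?wJ \<otimes> w0)) = len (n \<otimes> ?wJ) + len (?wJ \<otimes> w0)"
      unfolding XF using nw lw0[of n] lw0[of ?wJ] nc wJ by simp
    then have "\<delta> X F = n \<otimes> w0" using \<delta>_add[OF X(2) Y(2) F(2)] Y(3) F(3) XF by simp
    then show False using min[OF X\<Omega> F\<Omega> X(2) F(2) xnr(2)] xnr(6) by simp
  qed
  then show ?thesis using CD by auto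
qed

end

theorem theorem2:
  fixes W :: "('w, 'm) monoid_scheme" and I :: "'w set"
    and \<Delta> :: "'v set set" and \<tau> :: "'v \<Rightarrow> 'w" and \<A> :: "'v set set set"
    and \<Omega> :: "'v set set" and k :: 'w
  assumes "spherical_building W I \<Delta> \<tau> \<A>"
    and "irreducible_coxeter W I"
    and "convex_chamber_subcomplex I \<Delta> \<tau> \<Omega>"
    and "k \<in> I"
    and "\<And>v. {v} \<in> \<Omega> \<Longrightarrow> \<tau> v = k \<Longrightarrow> has_opposite_in I \<Delta> \<tau> \<A> \<Omega> {v}"
  shows "completely_reducible I \<Delta> \<tau> \<A> \<Omega>"
proof -
  have b: "building W I \<Delta> \<tau> \<A>" "finite (carrier W)" "coxeter_system W I"
    using assms(1) by (auto simp: spherical_building_def building_def)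
  then interpret spherical W I \<Delta> \<tau> \<A>
    by (simp add: spherical_def finite_coxeter_def coxeter_def coxeter_axioms_def finite_coxeter_axioms_def
        spherical_axioms_def coxeter_system_def)
  have face: "S \<in> \<Omega>" if "R \<in> \<Omega>" "S \<subseteq> R" for R S
    using assms(3) that unfolding convex_chamber_subcomplex_def chamber_subcomplex_def subcomplex_def by blast
  have in_chamber: "\<exists>C\<in>\<Omega>. Ch C \<and> R \<subseteq> C" if "R \<in> \<Omega>" for R
    using assms(3) that unfolding convex_chamber_subcomplex_def chamber_subcomplex_def by blast
  have opp: "\<exists>E\<in>\<Omega>. Ch E \<and> (\<exists>z\<in>generate W (I - {k}). \<delta> C E = z \<otimes>\<^bsub>W\<^esub> w0)" if C: "C \<in> \<Omega>" "Ch C" for C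
  proof -
    have "k \<in> \<tau> ` C" using C assms(4) by (simp add: chamber_def)
    then obtain v where v: "v \<in> C" "\<tau> v = k" by blast
    have "{v} \<in> \<Omega>" using face[OF C(1)] v by simp
    then obtain B where B: "B \<in> \<Omega>" "opposite I \<Delta> \<tau> \<A> {v} B"
      using assms(5) v unfolding has_opposite_in_def by blast
    obtain E where "E \<in> \<Omega>" "Ch E" "B \<subseteq> E" using in_chamber B by blast
    then show ?thesis using opposite_vertex_chamber[OF C(2) v] B(2) by blast
  qed
  show ?thesis
    unfolding completely_reducible_def has_opposite_in_def
  proof
    fix R assume "R \<in> \<Omega>"
    then obtain C where C: "C \<in> \<Omega>" "Ch C" "R \<subseteq> C" using in_chamber by blast
    have "\<exists>X\<in>\<Omega>. \<exists>Y\<in>\<Omega>. Ch X \<and> Ch Y \<and> \<delta> X Y = w0"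
      by (rule exists_opposite_chambers[OF assms(2,4,3) C(1,2)]) (rule opp)
    then obtain X Y where "X \<in> \<Omega>" "Y \<in> \<Omega>" "Ch X" "Ch Y" "\<delta> X Y = w0"
      by blast
    from opposite_pair_imp_all_chambers[OF assms(3) this C(2)]
    obtain D where D: "D \<in> \<Omega>" "Ch D" "\<delta> C D = w0" by blast
    obtain S where "S \<subseteq> D" "opposite I \<Delta> \<tau> \<A> R S" using opposite_face[OF C(2) D(2,3) C(3)] by blast
    then show "\<exists>S\<in>\<Omega>. opposite I \<Delta> \<tau> \<A> R S" using face D by blast
  qed
qed

end
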